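(* Let $g:\mathbb{R}^d\to\mathbb{R}^d$ satisfy Assumption (G) stated in the context, with fixed point $x^*$ and constants $\hat\rho>0$, $\kappa\in(0,1)$, $\hat\kappa>0$. Let $\{x_k\}$ and $\{r_k\}$ denote the iterates and residuals of the restarted Type-II Anderson mixing method described in the context with $\beta_k=1$ for all $k\ge0$. If $x_0$ is sufficiently close to $x^*$, then $$\|r_{k+1}\|_2\le\kappa\min_{p\in\mathcal{P}_{m_k},\,p(0)=1}\|p(A)r_{k-m_k}\|_2+\hat\kappa\,\mathcal{O}(\|x_{k-m_k}-x^*\|_2^2),$$ where $A:=I-g'(x^* )$. If $m_k=d$, then $\|x_{k+1}-x^*\|_2=\hat\kappa\,\mathcal{O}(\|x_{k-m_k}-x^*\|_2^2)$.
   Context: $\mathcal{P}_k$ is the space of polynomials of degree at most $k$; $g'$ is the Jacobian of $g$. Assumption (G): $g$ has a fixed point $x^*$. In $\mathcal{B}_{\hat\rho}(x^* ):=\{z\in\mathbb{R}^d:\|z-x^*\|_2\le\hat\rho\}$, for some constant $\hat\rho>0$, $g$ is Lipschitz continuously differentiable, and there are constants $\kappa\in(0,1)$ and $\hat\kappa>0$ such that $\|g(y)-g(x)\|_2\le\kappa\|y-x\|_2$ and $\|g'(y)-g'(x)\|_2\le\hat\kappa\|y-x\|_2$ for every $x,y\in\mathcal{B}_{\hat\rho}(x^* )$. Restarted Type-II Anderson mixing. Inputs: $x_0\in\mathbb{R}^d$, mixing parameters $\beta_k$, an integer $m$ with $0<m\le d$, $\tau\in(0,1)$, $\eta>0$.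 Set $m_0=0$. For $k=0,1,\dots$ until convergence (i.e. as long as $r_k\ne0$): (1) $r_k:=g(x_k)-x_k$. If $m_k>m$ or $\|r_k\|_2>\eta\|r_{k-m_k}\|_2$, reset $m_k:=0$. (2) If $m_k>0$: set $p_k:=x_k-x_{k-1}$, $q_k:=r_k-r_{k-1}$; for $j=1,\dots,m_k-1$ successively set $\zeta_k^{(j)}:=\frac{q_{k-m_k+j}^{\mathrm T}q_k}{q_{k-m_k+j}^{\mathrm T}q_{k-m_k+j}}$ and replace $p_k$ by $p_k-p_{k-m_k+j}\zeta_k^{(j)}$ and $q_k$ by $q_k-q_{k-m_k+j}\zeta_k^{(j)}$. Then, if $|q_k^{\mathrm T}q_k|<\tau|q_{k-m_k+1}^{\mathrm T}q_{k-m_k+1}|$, reset $m_k:=0$. (3) Set $\bar x_k:=x_k$, $\bar r_k:=r_k$; for $j=1,\dots,m_k$ successively set $\Gamma_k^{(j)}:=\frac{q_{k-m_k+j}^{\mathrm T}\bar r_k}{q_{k-m_k+j}^{\mathrm T}q_{k-m_k+j}}$ and replace $\bar x_k$ by $\bar x_k-p_{k-m_k+j}\Gamma_k^{(j)}$ and $\bar r_k$ by $\bar r_k-q_{k-m_k+j}\Gamma_k^{(j)}$. (4) $x_{k+1}:=\bar x_k+\beta_k\bar r_k$, $m_{k+1}:=m_k+1$ (possibly reset to $0$ in iteration $k+1$). In statements, $m_k$ denotes the final value in iteration $k$ (after possible resets). Convention. "If $x_0$ is sufficiently close to $x^*$, then ... $\hat\kappa\,\mathcal{O}(t)$" means: there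 are $\varepsilon>0$ and $C>0$, depending on $g$, $x^*$, the fixed constants and the method parameters ($m,\tau,\eta$) but not on $x_0$ or $k$, such that whenever $\|x_0-x^*\|_2\le\varepsilon$ the assertion holds with $\hat\kappa\,\mathcal{O}(t)$ standing for a quantity bounded in absolute value by $\hat\kappa Ct$. *)

theory Defs
  imports "HOL-Analysis.Analysis" "HOL-Computational_Algebra.Polynomial"
begin

text \<open>
  Derivatives are taken relative to the closed ball.  In the interior this is the ordinary Jacobian;
  on the boundary nothing is required of \<^term>\<open>g\<close> outside the ball.  The matrix norm is the spectral
  norm, hence \<^const>\<open>onorm\<close>: the norm of the type \<^typ>\<open>real^'n^'n\<close> is the Frobenius norm.
\<close>

definition assumption_G ::
  "(real^'n \<Rightarrow> real^'n) \<Rightarrow> real^'n \<Rightarrow> real \<Rightarrow> real \<Rightarrow> real \<Rightarrow> bool" where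
  "assumption_G g xstar \<rho> \<kappa> \<kappa>' \<longleftrightarrow>
     g xstar = xstar \<and> 0 < \<rho> \<and> 0 < \<kappa> \<and> \<kappa> < 1 \<and> 0 < \<kappa>' \<and>
     g differentiable_on cball xstar \<rho> \<and>
     (\<forall>x\<in>cball xstar \<rho>. \<forall>y\<in>cball xstar \<rho>.
        norm (g y - g x) \<le> \<kappa> * norm (y - x) \<and>
        onorm (\<lambda>v. (jacobian g (at y within cball xstar \<rho>)
                      - jacobian g (at x within cball xstar \<rho>)) *v v)
          \<le> \<kappa>' * norm (y - x))"

text \<open>
  The common inner loop of the method: for \<open>j = 1, \<dots>, n\<close> the pair \<open>(u, v)\<close> is replaced by
  \<open>(u - c p\<^sub>b\<^sub>+\<^sub>j, v - c q\<^sub>b\<^sub>+\<^sub>j)\<close> with \<open>c = (q\<^sub>b\<^sub>+\<^sub>j \<bullet> v) / (q\<^sub>b\<^sub>+\<^sub>j \<bullet> q\<^sub>b\<^sub>+\<^sub>j)\<close>, computed from the current \<open>v\<close>.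
  It is used both for the orthogonalisation of \<open>(p\<^sub>k, q\<^sub>k)\<close> (coefficients \<open>\<zeta>\<close>) and for the projection
  of \<open>(x\<^sub>k, r\<^sub>k)\<close> (coefficients \<open>\<Gamma>\<close>).
\<close>

primrec sweep ::
  "(nat \<Rightarrow> 'a::real_inner) \<Rightarrow> (nat \<Rightarrow> 'a) \<Rightarrow> nat \<Rightarrow> nat \<Rightarrow> 'a \<times> 'a \<Rightarrow> 'a \<times> 'a" where
  "sweep p q b 0 uv = uv"
| "sweep p q b (Suc n) uv =
     (let (u, v) = sweep p q b n uv;
          i = b + Suc n;
          c = (q i \<bullet> v) / (q i \<bullet> q i)
      in (u - c *\<^sub>R p i, v - c *\<^sub>R q i))"

text \<open>
  One full iteration \<open>k\<close>.  The sequence \<open>mm\<close> holds the final values of \<open>m\<^sub>k\<close>; \<open>m0\<close> is the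
  value on entry to iteration \<open>k\<close> and \<open>m1\<close> the value after the first reset test.  The sequences
  \<open>p\<close>, \<open>q\<close> hold the orthogonalised vectors and are unconstrained at \<open>k\<close> if \<open>m1 = 0\<close>.
\<close>

definition anderson_iteration ::
  "(nat \<Rightarrow> real) \<Rightarrow> nat \<Rightarrow> real \<Rightarrow> real \<Rightarrow>
   (nat \<Rightarrow> 'a::real_inner) \<Rightarrow> (nat \<Rightarrow> 'a) \<Rightarrow> (nat \<Rightarrow> 'a) \<Rightarrow> (nat \<Rightarrow> 'a) \<Rightarrow> (nat \<Rightarrow> nat) \<Rightarrow> nat \<Rightarrow> bool" where
  "anderson_iteration \<beta> m \<tau> \<eta> x r p q mm k \<longleftrightarrow>
     (let m0 = (case k of 0 \<Rightarrow> 0 | Suc i \<Rightarrow> mm i + 1);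
          m1 = (if m0 > m \<or> norm (r k) > \<eta> * norm (r (k - m0)) then 0 else m0)
      in (m1 > 0 \<longrightarrow>
            (p k, q k) = sweep p q (k - m1) (m1 - 1) (x k - x (k - 1), r k - r (k - 1))) \<and>
         mm k = (if m1 > 0 \<and>
                    \<bar>q k \<bullet> q k\<bar> < \<tau> * \<bar>q (k - m1 + 1) \<bullet> q (k - m1 + 1)\<bar> then 0 else m1) \<and>
         (let (xbar, rbar) = sweep p q (k - mm k) (mm k) (x k, r k)
          in x (k + 1) = xbar + \<beta> k *\<^sub>R rbar))"

text \<open>
  A run of the method.  It stops at the first \<open>k\<close> with \<open>r\<^sub>k = 0\<close>; all entries of the sequences
  that the method does not compute are unconstrained.
\<close>

definition restarted_anderson ::
  "('a::real_inner \<Rightarrow> 'a) \<Rightarrow> (nat \<Rightarrow> real) \<Rightarrow> nat \<Rightarrow> real \<Rightarrow> real \<Rightarrow> 'a \<Rightarrow>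
   (nat \<Rightarrow> 'a) \<Rightarrow> (nat \<Rightarrow> 'a) \<Rightarrow> (nat \<Rightarrow> 'a) \<Rightarrow> (nat \<Rightarrow> 'a) \<Rightarrow> (nat \<Rightarrow> nat) \<Rightarrow> bool" where
  "restarted_anderson g \<beta> m \<tau> \<eta> x0 x r p q mm \<longleftrightarrow>
     x 0 = x0 \<and>
     (\<forall>k. (\<forall>j<k. r j \<noteq> 0) \<longrightarrow>
        r k = g (x k) - x k \<and>
        (r k \<noteq> 0 \<longrightarrow> anderson_iteration \<beta> m \<tau> \<eta> x r p q mm k))"

text \<open>
  Powers are iterated \<open>**\<close>, since \<open>*\<close> and \<open>^\<close> on \<^typ>\<open>real^'n^'n\<close> act componentwise.
\<close>

definition matrix_poly :: "real poly \<Rightarrow> real^'n^'n \<Rightarrow> real^'n^'n" where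
  "matrix_poly p A = (\<Sum>i\<le>degree p. coeff p i *\<^sub>R (((**) A) ^^ i) (mat 1))"

definition min_poly_residual :: "nat \<Rightarrow> real^'n^'n \<Rightarrow> real^'n \<Rightarrow> real" where
  "min_poly_residual n A v =
     (INF p \<in> {p. degree p \<le> n \<and> poly p 0 = 1}. norm (matrix_poly p A *v v))"

text \<open>The infimum is a minimum.\<close>

lemma matrix_poly_mult_vec:
  fixes A :: "real^'n^'n" and v :: "real^'n"
  assumes "degree p \<le> n"
  shows "matrix_poly p A *v v = (\<Sum>i\<le>n. coeff p i *\<^sub>R ((((**) A) ^^ i) (mat 1) *v v))"
proof -
  have lin: "linear (\<lambda>M::real^'n^'n. M *v v)"
    by (rule linearI) (simp_all add: matrix_vector_mult_add_rdistrib scaleR_matrix_vector_assoc)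
  have "matrix_poly p A = (\<Sum>i\<le>n. coeff p i *\<^sub>R (((**) A) ^^ i) (mat 1))"
    unfolding matrix_poly_def
    by (rule sum.mono_neutral_left) (use assms in \<open>auto simp: coeff_eq_0\<close>)
  then show ?thesis
    by (simp add: linear_sum[OF lin] linear_cmul[OF lin])
qed

lemma min_poly_residual_attained:
  "\<exists>p. degree p \<le> n \<and> poly p 0 = 1 \<and> norm (matrix_poly p A *v v) = min_poly_residual n A v"
proof -
  let ?P = "{p::real poly. degree p \<le> n \<and> poly p 0 = 1}"
  let ?S = "(\<lambda>p. matrix_poly p A *v v) ` ?P"
  have aff: "affine ?S"
    unfolding affine_def
  proof (intro ballI allI impI)
    fix y z and a b :: real
    assume "y \<in> ?S" "z \<in> ?S" and ab: "a + b = 1"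
    then obtain p1 p2 where p: "p1 \<in> ?P" "y = matrix_poly p1 A *v v"
      "p2 \<in> ?P" "z = matrix_poly p2 A *v v" by blast
    let ?p = "smult a p1 + smult b p2"
    have P: "?p \<in> ?P"
      using p ab by (auto intro!: degree_add_le order.trans[OF degree_smult_le])
    then have "matrix_poly ?p A *v v = a *\<^sub>R y + b *\<^sub>R z"
      using p by (simp add: matrix_poly_mult_vec[where n = n] scaleR_sum_right
          scaleR_add_left sum.distrib)
    then show "a *\<^sub>R y + b *\<^sub>R z \<in> ?S" using P by (intro image_eqI[where x = ?p]) simp_all
  qed
  have "(1::real poly) \<in> ?P" by simp
  then have "?S \<noteq> {}" by blast
  moreover have "closed ?S" using aff by (rule affine_closed)
  ultimately obtain s where s: "s \<in> ?S" "\<And>y. y \<in> ?S \<Longrightarrow> dist 0 s \<le> dist 0 y"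
    using distance_attains_inf[of ?S 0] by blast
  then obtain p where p: "p \<in> ?P" "s = matrix_poly p A *v v" by blast
  have "min_poly_residual n A v = norm (matrix_poly p A *v v)"
    unfolding min_poly_residual_def
    by (rule cInf_eq_minimum) (use p s in \<open>auto simp: dist_norm\<close>)
  then show ?thesis using p by auto
qed

end

theory Submission
  imports Defs
begin

text \<open>
  Fix an index \<open>k\<close>, let \<open>s = k - m\<^sub>k\<close> be the start of its block, and measure everything against
  \<open>\<sigma> = \<parallel>r\<^sub>s\<parallel>\<close>, which is comparable to \<open>\<parallel>x\<^sub>s - x\<^sup>*\<parallel>\<close> because \<open>g\<close> is a contraction.  With
  \<open>A = I - g'(x\<^sup>*)\<close> every residual relation in the block is linear up to \<open>O(\<sigma>\<^sup>2)\<close>: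
  \<open>r\<^sub>j = -A (x\<^sub>j - x\<^sup>*) + O(\<sigma>\<^sup>2)\<close> and \<open>q\<^sub>j = -A p\<^sub>j + O(\<sigma>\<^sup>2)\<close>.  Hence the residual after the mixing step is
  \<open>r\<^sub>k\<^sub>+\<^sub>1 = (I - A) r' + O(\<sigma>\<^sup>2)\<close>, where \<open>r'\<close> is the projected residual, and \<open>\<parallel>I - A\<parallel> \<le> \<kappa>\<close> yields the
  factor \<open>\<kappa>\<close>.  It remains to compare \<open>\<parallel>r'\<parallel>\<close> with the polynomial minimum.

  The sweeps are a modified Gram-Schmidt process, so the \<open>q\<^sub>j\<close> are exactly orthogonal and \<open>r'\<close> is the
  shortest vector in \<open>r\<^sub>s + span {q\<^sub>j}\<close>.  The polynomial minimum is the distance of \<open>r\<^sub>s\<close> from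
  \<open>K = A (span {A\<^sup>l r\<^sub>s | l < m\<^sub>k})\<close>.  The recurrences show that each \<open>q\<^sub>j\<close> lies within \<open>O(\<sigma>\<^sup>2)\<close> of \<open>K\<close>
  (\<open>direction_near_krylov\<close>).  The converse, that every element of \<open>K\<close> of size \<open>O(\<sigma>)\<close> lies within
  \<open>O(\<sigma>\<^sup>2)\<close> of \<open>span {q\<^sub>j}\<close>, is a dimension count (\<open>perturbed_orthogonal_basis\<close>): the restart test keeps
  \<open>\<parallel>q\<^sub>j\<parallel> \<ge> c \<sigma>\<close>, so the nearby vectors of \<open>K\<close> are \<open>m\<^sub>k\<close> well-conditioned independent vectors in a space
  of dimension at most \<open>m\<^sub>k\<close>, hence a basis of it.  If \<open>m\<^sub>k = d\<close>, then the \<open>q\<^sub>j\<close> span the whole space and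
  \<open>r' = 0\<close>, which leaves only the quadratic term.

  All constants are uniform because a block bound with \<open>p = 1\<close> gives
  \<open>\<parallel>r\<^sub>k\<^sub>+\<^sub>1\<parallel> \<le> \<kappa> \<sigma> + C \<sigma>\<^sup>2 \<le> \<sigma>\<close> once \<open>\<sigma>\<close> is small; so no block starts with a larger residual than the
  previous one, and all iterates stay in the ball on which \<open>g\<close> is controlled
  (\<open>residuals_stay_small\<close>).
\<close>

section \<open>Gronwall's inequality and perturbed orthogonal bases\<close>

text \<open>
  Every vector of a block is built from all earlier ones with bounded coefficients; this is the form
  of Gronwall's inequality that keeps the resulting errors under control.
\<close>

lemma discrete_gronwall:
  fixes a :: "nat \<Rightarrow> real"
  assumes "0 \<le> B" "0 \<le> G"
    and step: "\<And>i. i < n \<Longrightarrow> a (Suc i) \<le> B + G * (\<Sum>j=1..i. a j)"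
    and "i < n"
  shows "a (Suc i) \<le> B * (1 + G) ^ i"
  using \<open>i < n\<close>
proof (induction i rule: less_induct)
  case (less i)
  have "(\<Sum>j=1..i. a j) = (\<Sum>j<i. a (Suc j))"
    by (simp add: sum.atLeast1_atMost_eq)
  also have "\<dots> \<le> (\<Sum>j<i. B * (1 + G) ^ j)"
    using less by (intro sum_mono) auto
  finally have "a (Suc i) \<le> B + G * (\<Sum>j<i. B * (1 + G) ^ j)"
    using step[OF less.prems] \<open>0 \<le> G\<close> by (smt (verit) mult_left_mono)
  also have "G * (\<Sum>j<i. B * (1 + G) ^ j) = B * ((1 + G) ^ i - 1)"
    using power_diff_1_eq[of "1 + G" i] by (simp add: sum_distrib_left mult.left_commute)
  finally show ?case by (simp add: algebra_simps)
qed

lemma norm_orthogonal_sum_ge: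
  fixes q :: "nat \<Rightarrow> 'a::real_inner"
  assumes "finite I"
    and orth: "\<And>i j. i \<in> I \<Longrightarrow> j \<in> I \<Longrightarrow> i \<noteq> j \<Longrightarrow> q i \<bullet> q j = 0"
    and "i \<in> I"
  shows "\<bar>a i\<bar> * norm (q i) \<le> norm (\<Sum>j\<in>I. a j *\<^sub>R q j)"
proof (cases "q i = 0")
  case False
  have "q i \<bullet> (\<Sum>j\<in>I. a j *\<^sub>R q j) = (\<Sum>j\<in>I. if j = i then a i * (q i \<bullet> q i) else 0)"
    unfolding inner_sum_right using assms by (intro sum.cong) auto
  then have "q i \<bullet> (\<Sum>j\<in>I. a j *\<^sub>R q j) = a i * norm (q i) ^ 2"
    using assms by (simp add: power2_norm_eq_inner)
  then have "\<bar>a i\<bar> * norm (q i) ^ 2 \<le> norm (q i) * norm (\<Sum>j\<in>I. a j *\<^sub>R q j)"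
    using Cauchy_Schwarz_ineq2[of "q i" "\<Sum>j\<in>I. a j *\<^sub>R q j"] by (simp add: abs_mult)
  then show ?thesis using False by (simp add: power2_eq_square)
qed simp

text \<open>
  The vectors \<open>q'\<^sub>i\<close> inherit a lower bound on their linear combinations from the orthogonal vectors
  \<open>q\<^sub>i\<close>, so they are independent, and since \<open>K\<close> has no larger dimension than their number they span it.
  The same bound controls the coefficients of \<open>z\<close> in this basis, and replacing \<open>q'\<^sub>i\<close> by \<open>q\<^sub>i\<close> under these
  coefficients costs a multiple of \<open>\<delta>\<close>.
\<close>

lemma perturbed_orthogonal_basis:
  fixes q q' :: "nat \<Rightarrow> 'a::euclidean_space"
  assumes fin: "finite I"
    and orth: "\<And>i j. i \<in> I \<Longrightarrow> j \<in> I \<Longrightarrow> i \<noteq> j \<Longrightarrow> q i \<bullet> q j = 0"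
    and lower: "\<And>i. i \<in> I \<Longrightarrow> b \<le> norm (q i)"
    and K: "subspace K" "dim K \<le> card I"
    and close: "\<And>i. i \<in> I \<Longrightarrow> q' i \<in> K" "\<And>i. i \<in> I \<Longrightarrow> norm (q i - q' i) \<le> \<delta>"
    and small: "0 < b" "0 \<le> \<delta>" "2 * real (card I) * \<delta> \<le> b"
    and "z \<in> K"
  obtains a where "norm (z - (\<Sum>i\<in>I. a i *\<^sub>R q i)) \<le> 2 * real (card I) * \<delta> * norm z / b"
proof -
  have coeff: "b * \<bar>a i\<bar> \<le> 2 * norm (\<Sum>j\<in>I. a j *\<^sub>R q' j)" if "i \<in> I" for a i
  proof -
    define M where "M = Max ((\<lambda>j. \<bar>a j\<bar>) ` I)"
    have M: "\<bar>a j\<bar> \<le> M" if "j \<in> I" for j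
      unfolding M_def using fin that by auto
    have "M \<in> (\<lambda>j. \<bar>a j\<bar>) ` I"
      unfolding M_def using fin that by (intro Max_in) auto
    then obtain l where l: "l \<in> I" "M = \<bar>a l\<bar>" by auto
    have "M * b \<le> \<bar>a l\<bar> * norm (q l)"
      using l lower by (auto intro: mult_left_mono)
    also have "\<dots> \<le> norm (\<Sum>j\<in>I. a j *\<^sub>R q j)"
      by (rule norm_orthogonal_sum_ge) (use fin orth l in auto)
    also have "(\<Sum>j\<in>I. a j *\<^sub>R q j) = (\<Sum>j\<in>I. a j *\<^sub>R q' j) + (\<Sum>j\<in>I. a j *\<^sub>R (q j - q' j))"
      by (simp add: algebra_simps sum_subtractf)
    also have "norm \<dots> \<le> norm (\<Sum>j\<in>I. a j *\<^sub>R q' j) + norm (\<Sum>j\<in>I. a j *\<^sub>R (q j - q' j))"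
      by (rule norm_triangle_ineq)
    also have "norm (\<Sum>j\<in>I. a j *\<^sub>R (q j - q' j)) \<le> (\<Sum>j\<in>I. M * \<delta>)"
      by (rule sum_norm_le) (use M close l in \<open>auto intro!: mult_mono\<close>)
    also have "\<dots> = M * (real (card I) * \<delta>)" by simp
    also have "\<dots> \<le> M * (b / 2)"
      using small l by (intro mult_left_mono) auto
    finally have "b * M \<le> 2 * norm (\<Sum>j\<in>I. a j *\<^sub>R q' j)" by (simp add: algebra_simps)
    then show ?thesis using M[OF that] small mult_left_mono[of "\<bar>a i\<bar>" M b] by linarith
  qed
  have inj: "inj_on q' I"
  proof (rule inj_onI, rule ccontr)
    fix i j assume ij: "i \<in> I" "j \<in> I" "q' i = q' j" "i \<noteq> j"
    \<comment> \<open>The combination \<open>q'\<^sub>i - q'\<^sub>j\<close> would vanish.\<close>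
    define a where "a = (\<lambda>l. if l = i then 1 else if l = j then -1 else (0::real))"
    have "(\<Sum>l\<in>I. a l *\<^sub>R q' l) = (\<Sum>l\<in>{i,j}. a l *\<^sub>R q' l)"
      by (rule sum.mono_neutral_right) (use fin ij in \<open>auto simp: a_def\<close>)
    also have "\<dots> = 0" using ij by (simp add: a_def)
    finally show False using coeff[OF ij(1), of a] small by (simp add: a_def)
  qed
  have indep: "independent (q' ` I)"
  proof (rule independent_if_scalars_zero)
    fix f v assume f: "(\<Sum>w\<in>q' ` I. f w *\<^sub>R w) = 0" and "v \<in> q' ` I"
    then obtain i where i: "i \<in> I" "v = q' i" by blast
    have "(\<Sum>j\<in>I. f (q' j) *\<^sub>R q' j) = 0" using f by (simp add: sum.reindex[OF inj])
    then have "b * \<bar>f (q' i)\<bar> \<le> 0"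
      using coeff[OF i(1), of "\<lambda>j. f (q' j)"] by simp
    then show "f v = 0" using small i by (simp add: mult_le_0_iff)
  qed (use fin in simp)
  have "K \<subseteq> span (q' ` I)"
    by (rule card_ge_dim_independent) (use indep close K inj in \<open>auto simp: card_image\<close>)
  then have "z \<in> span (q' ` I)" using \<open>z \<in> K\<close> by blast
  then obtain f where "z = (\<Sum>w\<in>q' ` I. f w *\<^sub>R w)"
    using fin by (auto simp: span_finite)
  then have z: "z = (\<Sum>j\<in>I. f (q' j) *\<^sub>R q' j)" by (simp add: sum.reindex[OF inj])
  let ?a = "\<lambda>j. f (q' j)"
  have a: "\<bar>?a j\<bar> \<le> 2 * norm z / b" if "j \<in> I" for j
    using coeff[OF that, of ?a] z small by (simp add: field_simps)
  have "norm (z - (\<Sum>i\<in>I. ?a i *\<^sub>R q i)) = norm (\<Sum>i\<in>I. ?a i *\<^sub>R (q' i - q i))"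
    by (subst (1) z) (simp add: sum_subtractf algebra_simps)
  also have "\<dots> \<le> (\<Sum>i\<in>I. 2 * norm z / b * \<delta>)"
  proof (rule sum_norm_le)
    fix i assume "i \<in> I"
    then show "norm (?a i *\<^sub>R (q' i - q i)) \<le> 2 * norm z / b * \<delta>"
      unfolding norm_scaleR norm_minus_commute[of "q' i"]
      using a close(2) small by (intro mult_mono) auto
  qed
  also have "\<dots> = 2 * real (card I) * \<delta> * norm z / b" by simp
  finally show thesis by (rule that)
qed

section \<open>The sweep as a Gram-Schmidt process\<close>

lemma orthogonal_norm_le_add:
  assumes "orthogonal a b"
  shows "norm a \<le> norm (a + b)"
  by (rule power2_le_imp_le) (simp_all add: norm_add_Pythagorean[OF assms])

text \<open>
  Each step of a sweep subtracts from \<open>v\<close> its projection onto one \<open>q\<^sub>j\<close>, so the norm of the second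
  component never grows.  By Cauchy-Schwarz this bounds the
  coefficients in terms of the initial \<open>v\<close>.
\<close>

lemma sweep_combination:
  obtains c where "sweep p q b n (u, v)
        = (u - (\<Sum>j=1..n. c j *\<^sub>R p (b + j)), v - (\<Sum>j=1..n. c j *\<^sub>R q (b + j)))"
    and "norm (v - (\<Sum>j=1..n. c j *\<^sub>R q (b + j))) \<le> norm v"
    and "\<And>j. j \<in> {1..n} \<Longrightarrow> \<bar>c j\<bar> * norm (q (b + j)) \<le> norm v"
proof -
  have "\<exists>c. sweep p q b n (u, v)
        = (u - (\<Sum>j=1..n. c j *\<^sub>R p (b + j)), v - (\<Sum>j=1..n. c j *\<^sub>R q (b + j)))
     \<and> norm (v - (\<Sum>j=1..n. c j *\<^sub>R q (b + j))) \<le> norm v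
     \<and> (\<forall>j\<in>{1..n}. \<bar>c j\<bar> * norm (q (b + j)) \<le> norm v)"
  proof (induction n)
    case (Suc n)
    then obtain c where c: "sweep p q b n (u, v)
        = (u - (\<Sum>j=1..n. c j *\<^sub>R p (b + j)), v - (\<Sum>j=1..n. c j *\<^sub>R q (b + j)))"
      "norm (v - (\<Sum>j=1..n. c j *\<^sub>R q (b + j))) \<le> norm v"
      "\<forall>j\<in>{1..n}. \<bar>c j\<bar> * norm (q (b + j)) \<le> norm v" by blast
    define w where "w = v - (\<Sum>j=1..n. c j *\<^sub>R q (b + j))"
    define d where "d = (q (b + Suc n) \<bullet> w) / (q (b + Suc n) \<bullet> q (b + Suc n))"
    define c' where "c' = c(Suc n := d)"
    have cong: "(\<Sum>j=1..Suc n. c' j *\<^sub>R y (b + j)) = (\<Sum>j=1..n. c j *\<^sub>R y (b + j)) + d *\<^sub>R y (b + Suc n)"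
      for y :: "nat \<Rightarrow> 'a"
      by (simp add: c'_def)
    have w': "norm (w - d *\<^sub>R q (b + Suc n)) \<le> norm w"
    proof -
      have "orthogonal (w - d *\<^sub>R q (b + Suc n)) (d *\<^sub>R q (b + Suc n))"
        by (auto simp: orthogonal_def d_def inner_commute algebra_simps)
      from orthogonal_norm_le_add[OF this] show ?thesis by (simp only: diff_add_cancel)
    qed
    have d: "\<bar>d\<bar> * norm (q (b + Suc n)) \<le> norm w"
    proof (cases "q (b + Suc n) = 0")
      case False
      have "\<bar>d\<bar> * norm (q (b + Suc n)) = \<bar>q (b + Suc n) \<bullet> w\<bar> / norm (q (b + Suc n))"
        using False by (simp add: d_def dot_square_norm abs_divide power2_eq_square)
      also have "\<dots> \<le> norm w"
        using Cauchy_Schwarz_ineq2[of "q (b + Suc n)" w] False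
        by (simp add: pos_divide_le_eq mult.commute)
      finally show ?thesis .
    qed simp
    have "norm w \<le> norm v" using c w_def by simp
    moreover have "sweep p q b (Suc n) (u, v)
        = (u - (\<Sum>j=1..Suc n. c' j *\<^sub>R p (b + j)), v - (\<Sum>j=1..Suc n. c' j *\<^sub>R q (b + j)))"
      unfolding cong by (simp only: sweep.simps c(1) w_def[symmetric] d_def Let_def prod.case diff_diff_eq[symmetric])
    moreover have "norm (v - (\<Sum>j=1..Suc n. c' j *\<^sub>R q (b + j))) \<le> norm v"
      unfolding cong diff_diff_eq[symmetric] w_def[symmetric]
      using w' \<open>norm w \<le> norm v\<close> by linarith
    moreover have "\<forall>j\<in>{1..Suc n}. \<bar>c' j\<bar> * norm (q (b + j)) \<le> norm v"
      using d \<open>norm w \<le> norm v\<close> c(3) by (auto simp: c'_def le_Suc_eq)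
    ultimately show ?case by blast
  qed simp
  then show thesis using that by blast
qed

lemma sweep_orthogonal:
  assumes "\<And>i j. i \<in> {1..n} \<Longrightarrow> j \<in> {1..n} \<Longrightarrow> i \<noteq> j \<Longrightarrow> q (b + i) \<bullet> q (b + j) = 0"
    and "j \<in> {1..n}"
  shows "q (b + j) \<bullet> snd (sweep p q b n uv) = 0"
  using assms
proof (induction n arbitrary: j)
  case (Suc n)
  obtain u v where uv: "sweep p q b n uv = (u, v)" by fastforce
  have "q (b + i) \<bullet> v = 0" if "i \<in> {1..n}" for i
    using Suc.IH[OF _ that] Suc.prems(1) uv by auto
  moreover have "q (b + j) \<bullet> q (b + Suc n) = 0" if "j \<noteq> Suc n"
    using Suc.prems(1)[of j "Suc n"] Suc.prems(2) that by simp
  ultimately show ?case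
    using Suc.prems(2) uv
    by (cases "j = Suc n") (auto simp: Let_def inner_diff_right)
qed simp

section \<open>One block over a linear model\<close>

text \<open>
  One block of the method, from its start \<open>s\<close> to the mixing step at \<open>s + n\<close>, with a linear map
  \<open>A\<close> that describes the residual differences up to \<open>D \<parallel>r\<^sub>s\<parallel>\<^sup>2\<close>.  The bound \<open>residual_bound\<close> comes from the first restart test
  and \<open>q_lower\<close> from the second.
\<close>

locale anderson_block =
  fixes A :: "'a::euclidean_space \<Rightarrow> 'a" and \<kappa> D H c :: real and m n s :: nat
    and x r p q :: "nat \<Rightarrow> 'a"
  assumes linear: "linear A"
    and kappa: "0 < \<kappa>" "\<kappa> < 1"
    and near_id: "\<And>v. norm (v - A v) \<le> \<kappa> * norm v"
    and const_pos: "0 \<le> D" "1 \<le> H" "0 < c"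
    and length: "n \<le> m"
    and start: "r s \<noteq> 0" "norm (r s) \<le> 1"
    and residual_bound: "\<And>i. i \<le> n \<Longrightarrow> norm (r (s + i)) \<le> H * norm (r s)"
    and q_lower: "\<And>i. 1 \<le> i \<Longrightarrow> i \<le> n \<Longrightarrow> c * norm (r s) \<le> norm (q (s + i))"
    and orthogonalised: "\<And>i. i < n \<Longrightarrow> (p (s + Suc i), q (s + Suc i)) =
          sweep p q s i (x (s + Suc i) - x (s + i), r (s + Suc i) - r (s + i))"
    and mixed: "\<And>i. i \<le> n \<Longrightarrow> x (s + Suc i) =
          (let (u, v) = sweep p q s i (x (s + i), r (s + i)) in u + v)"
    and linearised: "\<And>i. i < n \<Longrightarrow>
          norm (r (s + Suc i) - r (s + i) + A (x (s + Suc i) - x (s + i))) \<le> D * norm (r s) ^ 2"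
begin

text \<open>
  With \<open>\<sigma>\<close> the scale of the block, \<open>G\<close> bounds all sweep coefficients, \<open>E \<sigma>\<^sup>2\<close> the defect
  \<open>q\<^sub>j + A p\<^sub>j\<close>, \<open>P \<sigma>\<close> the vectors \<open>p\<^sub>j\<close>, and \<open>F \<sigma>\<^sup>2\<close> the distance of \<open>q\<^sub>j\<close> from the image under \<open>A\<close> of
  the Krylov space.  They depend on the length bound \<open>m\<close> instead of \<open>n\<close>, and so are the same for all blocks.
\<close>

definition "\<sigma> = norm (r s)"
definition "G = 2 * H / c"
definition "E = D * (1 + G) ^ m"
definition "P = (2 * H + E) / (1 - \<kappa>)"
definition "F = E + 2 * (m * G * E * (1 + 4 * G) ^ m)"

lemma sigma_pos: "0 < \<sigma>" and sigma_le_1: "\<sigma> \<le> 1"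
  using start by (auto simp: \<sigma>_def)

lemma const_nonneg: "0 \<le> G" "0 \<le> E" "0 \<le> P" "0 \<le> F"
proof -
  show G: "0 \<le> G" using const_pos by (simp add: G_def)
  show E: "0 \<le> E" using const_pos G by (simp add: E_def)
  show "0 \<le> P" using const_pos E kappa by (simp add: P_def)
  show "0 \<le> F" using E G by (simp add: F_def)
qed

lemma A_upper: "norm (A v) \<le> 2 * norm v"
proof -
  have "norm (A v) \<le> norm v + norm (v - A v)"
    using norm_triangle_ineq4[of v "v - A v"] by simp
  moreover have "\<kappa> * norm v \<le> norm v" using kappa by (simp add: mult_left_le_one_le)
  ultimately show ?thesis using near_id[of v] by linarith
qed

lemma A_lower: "(1 - \<kappa>) * norm v \<le> norm (A v)"
  using near_id[of v] norm_triangle_ineq2[of v "v - A v"] by (simp add: algebra_simps)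

text \<open>
  The lower bound on \<open>q\<^sub>j\<close> is of the same order \<open>\<sigma>\<close> as the vectors that are projected; this is why the
  coefficients are bounded independently of \<open>\<sigma>\<close>.
\<close>

lemma coefficient_bound:
  assumes "norm v \<le> 2 * H * \<sigma>" "j \<in> {1..n}" "\<bar>a\<bar> * norm (q (s + j)) \<le> norm v"
  shows "\<bar>a\<bar> \<le> G"
proof -
  have "\<bar>a\<bar> * (c * \<sigma>) \<le> \<bar>a\<bar> * norm (q (s + j))"
    using q_lower[of j] assms(2) by (intro mult_left_mono) (auto simp: \<sigma>_def)
  then have "\<bar>a\<bar> * c * \<sigma> \<le> 2 * H * \<sigma>" using assms by simp
  then have "\<bar>a\<bar> * c \<le> 2 * H" using sigma_pos by simp
  then show ?thesis using const_pos by (simp add: G_def pos_le_divide_eq)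
qed

lemma step_bound: "i < n \<Longrightarrow> norm (r (s + Suc i) - r (s + i)) \<le> 2 * H * \<sigma>"
  using residual_bound[of i] residual_bound[of "Suc i"] norm_triangle_ineq4[of "r (s + Suc i)" "r (s + i)"]
  by (simp add: \<sigma>_def)

lemma direction:
  assumes "i < n"
  obtains \<zeta> where
    "p (s + Suc i) = x (s + Suc i) - x (s + i) - (\<Sum>j=1..i. \<zeta> j *\<^sub>R p (s + j))"
    "q (s + Suc i) = r (s + Suc i) - r (s + i) - (\<Sum>j=1..i. \<zeta> j *\<^sub>R q (s + j))"
    "norm (q (s + Suc i)) \<le> 2 * H * \<sigma>"
    "\<And>j. j \<in> {1..i} \<Longrightarrow> \<bar>\<zeta> j\<bar> \<le> G"
proof -
  let ?v = "r (s + Suc i) - r (s + i)"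
  obtain \<zeta> where z: "sweep p q s i (x (s + Suc i) - x (s + i), ?v)
        = (x (s + Suc i) - x (s + i) - (\<Sum>j=1..i. \<zeta> j *\<^sub>R p (s + j)), ?v - (\<Sum>j=1..i. \<zeta> j *\<^sub>R q (s + j)))"
    "norm (?v - (\<Sum>j=1..i. \<zeta> j *\<^sub>R q (s + j))) \<le> norm ?v"
    "\<And>j. j \<in> {1..i} \<Longrightarrow> \<bar>\<zeta> j\<bar> * norm (q (s + j)) \<le> norm ?v"
    using sweep_combination[of p q s i "x (s + Suc i) - x (s + i)" ?v] by blast
  have pq: "p (s + Suc i) = x (s + Suc i) - x (s + i) - (\<Sum>j=1..i. \<zeta> j *\<^sub>R p (s + j))"
    "q (s + Suc i) = ?v - (\<Sum>j=1..i. \<zeta> j *\<^sub>R q (s + j))"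
    using orthogonalised[OF assms] z(1) by auto
  show thesis
  proof (rule that[OF pq])
    show "norm (q (s + Suc i)) \<le> 2 * H * \<sigma>"
      using pq(2) z(2) step_bound[OF assms] by simp
    show "\<bar>\<zeta> j\<bar> \<le> G" if "j \<in> {1..i}" for j
      using coefficient_bound[OF step_bound[OF assms], of j] z(3)[OF that] that assms by simp
  qed
qed

lemma q_orthogonal:
  assumes "i \<in> {1..n}" "j \<in> {1..n}" "i \<noteq> j"
  shows "q (s + i) \<bullet> q (s + j) = 0"
proof -
  have "\<forall>i\<in>{1..l}. \<forall>j\<in>{1..l}. i \<noteq> j \<longrightarrow> q (s + i) \<bullet> q (s + j) = 0" if "l \<le> n" for l
    using that
  proof (induction l)
    case (Suc l)
    have new: "q (s + j) \<bullet> q (s + Suc l) = 0" if "j \<in> {1..l}" for j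
    proof -
      have "q (s + j) \<bullet> snd (sweep p q s l (x (s + Suc l) - x (s + l), r (s + Suc l) - r (s + l))) = 0"
        by (rule sweep_orthogonal) (use Suc that in auto)
      then show ?thesis using orthogonalised[of l] Suc.prems by (metis Suc_le_lessD snd_conv)
    qed
    have split: "{1..Suc l} = insert (Suc l) {1..l}" by auto
    have new': "q (s + Suc l) \<bullet> q (s + j) = 0" if "j \<in> {1..l}" for j
      using new[OF that] by (simp add: inner_commute)
    have old: "\<forall>i\<in>{1..l}. \<forall>j\<in>{1..l}. i \<noteq> j \<longrightarrow> q (s + i) \<bullet> q (s + j) = 0"
      using Suc by simp
    show ?case unfolding split using new new' old by blast
  qed simp
  from this[of n] assms show ?thesis by blast
qed

text \<open>
  The pair \<open>(p, q)\<close> undergoes the same linear operations in both components, so the defect \<open>q + A p\<close>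
  obeys the recurrence of the directions, with the linearisation error as its source.
\<close>

lemma direction_consistent:
  assumes "i < n"
  shows "norm (q (s + Suc i) + A (p (s + Suc i))) \<le> E * \<sigma> ^ 2"
proof -
  let ?a = "\<lambda>i. norm (q (s + i) + A (p (s + i)))"
  have step: "?a (Suc i) \<le> D * \<sigma> ^ 2 + G * (\<Sum>j=1..i. ?a j)" if "i < n" for i
  proof -
    obtain \<zeta> where z:
      "p (s + Suc i) = x (s + Suc i) - x (s + i) - (\<Sum>j=1..i. \<zeta> j *\<^sub>R p (s + j))"
      "q (s + Suc i) = r (s + Suc i) - r (s + i) - (\<Sum>j=1..i. \<zeta> j *\<^sub>R q (s + j))"
      "\<And>j. j \<in> {1..i} \<Longrightarrow> \<bar>\<zeta> j\<bar> \<le> G"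
      using direction[OF \<open>i < n\<close>] by blast
    have "q (s + Suc i) + A (p (s + Suc i))
        = (r (s + Suc i) - r (s + i) + A (x (s + Suc i) - x (s + i)))
          - (\<Sum>j=1..i. \<zeta> j *\<^sub>R (q (s + j) + A (p (s + j))))"
      by (simp add: z(1,2) linear_diff[OF linear] linear_sum[OF linear] linear_cmul[OF linear]
          scaleR_add_right sum.distrib del: add_Suc_right)
    also have "norm \<dots> \<le> D * \<sigma> ^ 2 + norm (\<Sum>j=1..i. \<zeta> j *\<^sub>R (q (s + j) + A (p (s + j))))"
      using linearised[OF that] by (intro order_trans[OF norm_triangle_ineq4]) (simp add: \<sigma>_def)
    also have "norm (\<Sum>j=1..i. \<zeta> j *\<^sub>R (q (s + j) + A (p (s + j)))) \<le> (\<Sum>j=1..i. G * ?a j)"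
      by (rule sum_norm_le) (use z(3) in \<open>auto intro!: mult_right_mono\<close>)
    finally show ?thesis by (simp add: sum_distrib_left)
  qed
  have "?a (Suc i) \<le> D * \<sigma> ^ 2 * (1 + G) ^ i"
    by (rule discrete_gronwall[where a = ?a and n = n, OF _ const_nonneg(1) step assms])
      (use const_pos in simp_all)
  also have "\<dots> \<le> D * \<sigma> ^ 2 * (1 + G) ^ m"
    using const_pos const_nonneg assms length by (intro mult_left_mono power_increasing) auto
  finally show ?thesis by (simp add: E_def mult_ac)
qed

lemma direction_bound:
  assumes "i \<in> {1..n}"
  shows "norm (p (s + i)) \<le> P * \<sigma>"
proof -
  obtain i' where i': "i = Suc i'" "i' < n" using assms by (cases i) auto
  have q: "norm (q (s + i)) \<le> 2 * H * \<sigma>"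
    unfolding i'(1) using direction[OF i'(2)] by blast
  have "E * \<sigma> ^ 2 \<le> E * \<sigma>"
    using sigma_pos sigma_le_1 const_nonneg
    by (intro mult_left_mono) (auto simp: power2_eq_square)
  then have "norm (A (p (s + i))) \<le> (2 * H + E) * \<sigma>"
    using q direction_consistent[OF i'(2)] i'(1)
      norm_triangle_ineq4[of "q (s + i) + A (p (s + i))" "q (s + i)"]
    by (simp add: algebra_simps)
  then have "(1 - \<kappa>) * norm (p (s + i)) \<le> (2 * H + E) * \<sigma>"
    using A_lower order_trans by blast
  then show ?thesis using kappa by (simp add: P_def pos_le_divide_eq mult.commute)
qed

definition "xbar i = fst (sweep p q s i (x (s + i), r (s + i)))"
definition "rbar i = snd (sweep p q s i (x (s + i), r (s + i)))"

lemma next_iterate: "i \<le> n \<Longrightarrow> x (s + Suc i) = xbar i + rbar i"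
  using mixed[of i] by (simp add: xbar_def rbar_def case_prod_unfold Let_def)

lemma projection:
  assumes "i \<le> n"
  obtains \<Gamma> where
    "xbar i = x (s + i) - (\<Sum>j=1..i. \<Gamma> j *\<^sub>R p (s + j))"
    "rbar i = r (s + i) - (\<Sum>j=1..i. \<Gamma> j *\<^sub>R q (s + j))"
    "norm (rbar i) \<le> H * \<sigma>"
    "\<And>j. j \<in> {1..i} \<Longrightarrow> \<bar>\<Gamma> j\<bar> \<le> G"
proof -
  obtain \<Gamma> where g: "sweep p q s i (x (s + i), r (s + i))
        = (x (s + i) - (\<Sum>j=1..i. \<Gamma> j *\<^sub>R p (s + j)), r (s + i) - (\<Sum>j=1..i. \<Gamma> j *\<^sub>R q (s + j)))"
    "norm (r (s + i) - (\<Sum>j=1..i. \<Gamma> j *\<^sub>R q (s + j))) \<le> norm (r (s + i))"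
    "\<And>j. j \<in> {1..i} \<Longrightarrow> \<bar>\<Gamma> j\<bar> * norm (q (s + j)) \<le> norm (r (s + i))"
    using sweep_combination[of p q s i "x (s + i)" "r (s + i)"] by blast
  have r: "norm (r (s + i)) \<le> H * \<sigma>" using residual_bound[OF assms] by (simp add: \<sigma>_def)
  moreover have "0 \<le> H * \<sigma>" using const_pos sigma_pos by simp
  ultimately have r2: "norm (r (s + i)) \<le> 2 * H * \<sigma>" by linarith
  show thesis
  proof (rule that[of \<Gamma>])
    show "xbar i = x (s + i) - (\<Sum>j=1..i. \<Gamma> j *\<^sub>R p (s + j))"
      "rbar i = r (s + i) - (\<Sum>j=1..i. \<Gamma> j *\<^sub>R q (s + j))"
      using g(1) by (auto simp: xbar_def rbar_def)
    show "norm (rbar i) \<le> H * \<sigma>"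
      using g(1,2) r by (simp add: rbar_def)
    show "\<bar>\<Gamma> j\<bar> \<le> G" if "j \<in> {1..i}" for j
      by (rule coefficient_bound[OF r2, of j]) (use that assms g(3) in auto)
  qed
qed

lemma rbar_orthogonal:
  assumes "i \<le> n" "j \<in> {1..i}"
  shows "q (s + j) \<bullet> rbar i = 0"
  unfolding rbar_def by (rule sweep_orthogonal) (use assms q_orthogonal in auto)

lemma residual_in_span:
  assumes "i \<le> n"
  shows "r (s + i) - r s \<in> span ((\<lambda>j. q (s + j)) ` {1..i})"
  using assms
proof (induction i)
  case (Suc i)
  obtain \<zeta> where z: "q (s + Suc i) = r (s + Suc i) - r (s + i) - (\<Sum>j=1..i. \<zeta> j *\<^sub>R q (s + j))"
    using direction[OF Suc_le_lessD[OF Suc.prems]] by blast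
  let ?S = "span ((\<lambda>j. q (s + j)) ` {1..Suc i})"
  have "r (s + i) - r s \<in> ?S"
    using Suc span_mono[of "(\<lambda>j. q (s + j)) ` {1..i}" "(\<lambda>j. q (s + j)) ` {1..Suc i}"] by fastforce
  moreover have "(\<Sum>j=1..i. \<zeta> j *\<^sub>R q (s + j)) \<in> ?S"
    by (intro span_sum span_scale span_base) auto
  moreover have "q (s + Suc i) \<in> ?S" by (intro span_base imageI) simp
  ultimately have "(r (s + i) - r s) + (q (s + Suc i) + (\<Sum>j=1..i. \<zeta> j *\<^sub>R q (s + j))) \<in> ?S"
    by (intro span_add)
  then show ?case by (simp add: z del: add_Suc_right)
qed (simp add: span_zero)

lemma rbar_in_span:
  assumes "i \<le> n"
  shows "rbar i - r s \<in> span ((\<lambda>j. q (s + j)) ` {1..i})"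
proof -
  obtain \<Gamma> where g: "rbar i = r (s + i) - (\<Sum>j=1..i. \<Gamma> j *\<^sub>R q (s + j))"
    using projection[OF assms] by blast
  have "(\<Sum>j=1..i. \<Gamma> j *\<^sub>R q (s + j)) \<in> span ((\<lambda>j. q (s + j)) ` {1..i})"
    by (intro span_sum span_scale span_base) auto
  with residual_in_span[OF assms]
  have "(r (s + i) - r s) - (\<Sum>j=1..i. \<Gamma> j *\<^sub>R q (s + j)) \<in> span ((\<lambda>j. q (s + j)) ` {1..i})"
    by (rule span_diff)
  then show ?thesis by (simp add: g algebra_simps)
qed

text \<open>
  The projected residual differs from \<open>r\<^sub>s\<close> by an element of the span to which it is orthogonal.
\<close>

lemma rbar_minimal:
  assumes "i \<le> n" "w \<in> span ((\<lambda>j. q (s + j)) ` {1..i})"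
  shows "norm (rbar i) \<le> norm (r s - w)"
proof -
  have "orthogonal (rbar i) y" if "y \<in> span ((\<lambda>j. q (s + j)) ` {1..i})" for y
    by (rule orthogonal_to_span[OF that])
      (use rbar_orthogonal[OF assms(1)] in \<open>auto simp: orthogonal_def inner_commute\<close>)
  then have "orthogonal (rbar i) (- ((rbar i - r s) + w))"
    using rbar_in_span[OF assms(1)] assms(2) span_add span_neg by blast
  from orthogonal_norm_le_add[OF this] show ?thesis by simp
qed

text \<open>
  Expressing \<open>rbar i\<close> through \<open>r\<^sub>s\<close> instead of \<open>r\<^sub>s\<^sub>+\<^sub>i\<close> makes the seed of the Krylov space visible.  The
  coefficients remain bounded because the \<open>q\<^sub>j\<close> are orthogonal.
\<close>

lemma rbar_combination:
  assumes "i \<le> n"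
  obtains b where "rbar i = r s + (\<Sum>j=1..i. b j *\<^sub>R q (s + j))" "\<And>j. j \<in> {1..i} \<Longrightarrow> \<bar>b j\<bar> \<le> G"
proof -
  let ?q = "\<lambda>j. q (s + j)"
  have qq: "?q a \<bullet> ?q b = 0" if "a \<in> {1..i}" "b \<in> {1..i}" "a \<noteq> b" for a b
    using q_orthogonal that assms by auto
  have nz: "?q a \<noteq> 0" if "a \<in> {1..i}" for a
    using q_lower[of a] that assms mult_pos_pos[OF const_pos(3) sigma_pos] by (auto simp: \<sigma>_def)
  have inj: "inj_on ?q {1..i}"
  proof (rule inj_onI, rule ccontr)
    fix a b assume ab: "a \<in> {1..i}" "b \<in> {1..i}" "?q a = ?q b" "a \<noteq> b"
    then have "?q a \<bullet> ?q a = 0" using qq[OF ab(1,2,4)] by simp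
    then show False using nz[OF ab(1)] by simp
  qed
  obtain f where "rbar i - r s = (\<Sum>v\<in>?q ` {1..i}. f v *\<^sub>R v)"
    using rbar_in_span[OF assms] by (auto simp: span_finite)
  then have f: "rbar i - r s = (\<Sum>j=1..i. f (?q j) *\<^sub>R ?q j)"
    by (simp only: sum.reindex[OF inj] o_def)
  show thesis
  proof (rule that[of "\<lambda>j. f (?q j)"])
    show "rbar i = r s + (\<Sum>j=1..i. f (?q j) *\<^sub>R ?q j)" using f by (simp add: algebra_simps)
    show "\<bar>f (?q j)\<bar> \<le> G" if j: "j \<in> {1..i}" for j
    proof (rule coefficient_bound[of "rbar i - r s" j])
      have "norm (rbar i) \<le> H * \<sigma>" using projection[OF assms] by blast
      moreover have "norm (r s) \<le> H * \<sigma>"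
        using const_pos sigma_pos by (simp add: \<sigma>_def)
      ultimately show "norm (rbar i - r s) \<le> 2 * H * \<sigma>"
        using norm_triangle_ineq4[of "rbar i" "r s"] by linarith
      show "j \<in> {1..n}" using j assms by auto
      show "\<bar>f (?q j)\<bar> * norm (?q j) \<le> norm (rbar i - r s)"
        unfolding f by (rule norm_orthogonal_sum_ge[where q = ?q]) (use j qq in auto)
    qed
  qed
qed

definition "krylov i = span ((\<lambda>l. (A ^^ l) (r s)) ` {..<i})"

lemma krylov_mono: "i \<le> j \<Longrightarrow> krylov i \<subseteq> krylov j"
  unfolding krylov_def by (intro span_mono image_mono) auto

lemma A_krylov: "v \<in> krylov i \<Longrightarrow> A v \<in> krylov (Suc i)"
proof -
  assume "v \<in> krylov i"
  then have "A v \<in> span (A ` (\<lambda>l. (A ^^ l) (r s)) ` {..<i})"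
    unfolding krylov_def using linear_span_image[OF linear] by blast
  moreover have "A ` (\<lambda>l. (A ^^ l) (r s)) ` {..<i} \<subseteq> (\<lambda>l. (A ^^ l) (r s)) ` {..<Suc i}"
  proof clarify
    fix l assume "l < i"
    then show "A ((A ^^ l) (r s)) \<in> (\<lambda>l. (A ^^ l) (r s)) ` {..<Suc i}"
      by (intro image_eqI[of _ _ "Suc l"]) auto
  qed
  ultimately show ?thesis unfolding krylov_def using span_mono by blast
qed

lemma dim_krylov: "dim (krylov i) \<le> i"
proof -
  have "dim (krylov i) \<le> card ((\<lambda>l. (A ^^ l) (r s)) ` {..<i})"
    unfolding krylov_def dim_span by (rule dim_le_card') simp
  also have "\<dots> \<le> i" using card_image_le[of "{..<i}"] by simp
  finally show ?thesis .
qed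

text \<open>
  By \<open>rbar_combination\<close> the next direction \<open>p\<close> equals \<open>r\<^sub>s\<close> plus a bounded combination of the earlier \<open>p\<^sub>j\<close>
  and \<open>q\<^sub>j\<close>.  Replacing \<open>p\<^sub>j\<close> by its Krylov approximation \<open>p'\<^sub>j\<close> and \<open>q\<^sub>j\<close> by \<open>-A p'\<^sub>j\<close> in this recurrence
  produces an element of the next Krylov space, and the errors are summed by Gronwall's inequality.
\<close>

lemma direction_near_krylov:
  shows "\<exists>p'. \<forall>i\<in>{1..n}. p' i \<in> krylov i \<and>
     norm (p (s + i) - p' i) \<le> m * G * E * (1 + 4 * G) ^ m * \<sigma> ^ 2"
proof -
  define B where "B = m * G * E * \<sigma> ^ 2"
  have "\<exists>p'. \<forall>i\<in>{1..l}. p' i \<in> krylov i \<and>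
       norm (p (s + i) - p' i) \<le> B + 4 * G * (\<Sum>j=1..i-1. norm (p (s + j) - p' j))"
    if "l \<le> n" for l
    using that
  proof (induction l)
    case (Suc l)
    then have "l \<le> n" by simp
    from Suc.IH[OF this] obtain p' where p': "\<And>i. i \<in> {1..l} \<Longrightarrow> p' i \<in> krylov i"
      "\<And>i. i \<in> {1..l} \<Longrightarrow> norm (p (s + i) - p' i) \<le> B + 4 * G * (\<Sum>j=1..i-1. norm (p (s + j) - p' j))"
      by blast
    have l: "l < n" "l \<le> n" using Suc.prems by auto
    obtain \<zeta> where z: "p (s + Suc l) = x (s + Suc l) - x (s + l) - (\<Sum>j=1..l. \<zeta> j *\<^sub>R p (s + j))"
      "\<And>j. j \<in> {1..l} \<Longrightarrow> \<bar>\<zeta> j\<bar> \<le> G"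
      using direction[OF l(1)] by blast
    obtain \<Gamma> where g: "xbar l = x (s + l) - (\<Sum>j=1..l. \<Gamma> j *\<^sub>R p (s + j))"
      "\<And>j. j \<in> {1..l} \<Longrightarrow> \<bar>\<Gamma> j\<bar> \<le> G"
      using projection[OF l(2)] by blast
    obtain b where b: "rbar l = r s + (\<Sum>j=1..l. b j *\<^sub>R q (s + j))" "\<And>j. j \<in> {1..l} \<Longrightarrow> \<bar>b j\<bar> \<le> G"
      using rbar_combination[OF l(2)] by blast
    have p_eq: "p (s + Suc l) = r s + (\<Sum>j=1..l. b j *\<^sub>R q (s + j))
        - (\<Sum>j=1..l. \<Gamma> j *\<^sub>R p (s + j)) - (\<Sum>j=1..l. \<zeta> j *\<^sub>R p (s + j))"
      using z(1) g(1) b(1) next_iterate[OF l(2)] by simp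
    \<comment> \<open>The recurrence \<open>p_eq\<close> for the model vectors \<open>p'\<^sub>j\<close> and \<open>- A p'\<^sub>j\<close>.\<close>
    define w where "w = r s + (\<Sum>j=1..l. b j *\<^sub>R (- A (p' j)))
        - (\<Sum>j=1..l. \<Gamma> j *\<^sub>R p' j) - (\<Sum>j=1..l. \<zeta> j *\<^sub>R p' j)"
    have "r s \<in> krylov (Suc l)"
      unfolding krylov_def by (intro span_base image_eqI[of _ _ 0]) auto
    moreover have "p' j \<in> krylov (Suc l)" if "j \<in> {1..l}" for j
      using p'(1)[OF that] krylov_mono[of j "Suc l"] that by auto
    moreover have "- A (p' j) \<in> krylov (Suc l)" if "j \<in> {1..l}" for j
      using A_krylov[OF p'(1)[OF that]] krylov_mono[of "Suc j" "Suc l"] that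
      by (auto simp: krylov_def intro: span_neg)
    ultimately have w: "w \<in> krylov (Suc l)"
      unfolding w_def krylov_def by (intro span_diff span_add span_sum span_scale) auto
    let ?e = "\<lambda>j. norm (p (s + j) - p' j)"
    have "p (s + Suc l) - w = (\<Sum>j=1..l. b j *\<^sub>R (q (s + j) + A (p' j))
        - \<Gamma> j *\<^sub>R (p (s + j) - p' j) - \<zeta> j *\<^sub>R (p (s + j) - p' j))"
      unfolding p_eq w_def by (simp add: sum.distrib sum_subtractf algebra_simps sum_negf)
    also have "norm \<dots> \<le> (\<Sum>j=1..l. G * E * \<sigma> ^ 2 + 4 * G * ?e j)"
    proof (rule sum_norm_le)
      fix j assume j: "j \<in> {1..l}"
      then obtain j' where j': "j = Suc j'" "j' < n" using l by (cases j) auto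
      have "norm (q (s + j) + A (p' j)) \<le> norm (q (s + j) + A (p (s + j))) + norm (A (p (s + j) - p' j))"
        using norm_triangle_ineq4[of "q (s + j) + A (p (s + j))" "A (p (s + j) - p' j)"]
        by (simp add: linear_diff[OF linear])
      also have "\<dots> \<le> E * \<sigma> ^ 2 + 2 * ?e j"
        using direction_consistent[OF j'(2)] A_upper j'(1) by (intro add_mono) auto
      finally have "\<bar>b j\<bar> * norm (q (s + j) + A (p' j)) \<le> G * (E * \<sigma> ^ 2 + 2 * ?e j)"
        using b(2)[OF j] const_nonneg by (intro mult_mono) auto
      moreover have "\<bar>\<Gamma> j\<bar> * ?e j \<le> G * ?e j" "\<bar>\<zeta> j\<bar> * ?e j \<le> G * ?e j"
        using g(2)[OF j] z(2)[OF j] by (auto intro: mult_right_mono)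
      moreover have "norm (b j *\<^sub>R (q (s + j) + A (p' j)) - \<Gamma> j *\<^sub>R (p (s + j) - p' j) - \<zeta> j *\<^sub>R (p (s + j) - p' j))
          \<le> \<bar>b j\<bar> * norm (q (s + j) + A (p' j)) + \<bar>\<Gamma> j\<bar> * ?e j + \<bar>\<zeta> j\<bar> * ?e j"
        unfolding norm_scaleR[symmetric]
        by (rule order_trans[OF norm_triangle_ineq4 add_right_mono[OF norm_triangle_ineq4]])
      ultimately show "norm (b j *\<^sub>R (q (s + j) + A (p' j)) - \<Gamma> j *\<^sub>R (p (s + j) - p' j) - \<zeta> j *\<^sub>R (p (s + j) - p' j))
          \<le> G * E * \<sigma> ^ 2 + 4 * G * ?e j"
        by (simp add: algebra_simps)
    qed
    also have "\<dots> = real l * (G * E * \<sigma> ^ 2) + 4 * G * (\<Sum>j=1..l. ?e j)"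
      by (simp add: sum.distrib sum_distrib_left)
    also have "real l * (G * E * \<sigma> ^ 2) \<le> B"
      unfolding B_def mult.assoc using const_nonneg l length by (intro mult_right_mono) auto
    finally have step: "norm (p (s + Suc l) - w) \<le> B + 4 * G * (\<Sum>j=1..l. ?e j)" by simp
    let ?p' = "p'(Suc l := w)"
    have eq: "(\<Sum>j=1..i. norm (p (s + j) - ?p' j)) = (\<Sum>j=1..i. ?e j)" if "i \<le> l" for i
      using that by (intro sum.cong) auto
    have "\<forall>i\<in>{1..Suc l}. ?p' i \<in> krylov i \<and>
       norm (p (s + i) - ?p' i) \<le> B + 4 * G * (\<Sum>j=1..i-1. norm (p (s + j) - ?p' j))"
    proof
      fix i assume i: "i \<in> {1..Suc l}"
      show "?p' i \<in> krylov i \<and>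
       norm (p (s + i) - ?p' i) \<le> B + 4 * G * (\<Sum>j=1..i-1. norm (p (s + j) - ?p' j))"
      proof (cases "i = Suc l")
        case True
        then show ?thesis using w step eq[of l] by simp
      next
        case False
        then have "i \<in> {1..l}" using i by auto
        moreover from this have "i - 1 \<le> l" by auto
        ultimately show ?thesis unfolding eq[OF \<open>i - 1 \<le> l\<close>] using p' False by simp
      qed
    qed
    then show ?case by blast
  qed simp
  from this[of n] obtain p' where p': "\<And>i. i \<in> {1..n} \<Longrightarrow> p' i \<in> krylov i"
    "\<And>i. i \<in> {1..n} \<Longrightarrow> norm (p (s + i) - p' i) \<le> B + 4 * G * (\<Sum>j=1..i-1. norm (p (s + j) - p' j))"
    by blast
  have B: "0 \<le> B" using const_nonneg by (simp add: B_def)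
  have "norm (p (s + i) - p' i) \<le> B * (1 + 4 * G) ^ m" if i: "i \<in> {1..n}" for i
  proof -
    obtain i' where i': "i = Suc i'" "i' < n" using i by (cases i) auto
    have "norm (p (s + Suc i') - p' (Suc i')) \<le> B * (1 + 4 * G) ^ i'"
    proof (rule discrete_gronwall[where a = "\<lambda>i. norm (p (s + i) - p' i)"])
      show "norm (p (s + Suc i) - p' (Suc i)) \<le> B + 4 * G * (\<Sum>j=1..i. norm (p (s + j) - p' j))"
        if "i < n" for i
        using p'(2)[of "Suc i"] that by simp
    qed (use B const_nonneg i' in auto)
    also have "\<dots> \<le> B * (1 + 4 * G) ^ m"
      using B const_nonneg i' length by (intro mult_left_mono power_increasing) auto
    finally show ?thesis using i' by simp
  qed
  with p'(1) show ?thesis by (intro exI[of _ p']) (auto simp: B_def mult_ac)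
qed

text \<open>
  The form with an arbitrary subspace \<open>K\<close> serves twice: with the image of the Krylov space for the
  polynomial bound, and with the whole space when the block has full length.
\<close>

lemma rbar_le_residual:
  assumes K: "subspace K" "dim K \<le> n"
    and q': "\<And>i. i \<in> {1..n} \<Longrightarrow> q' i \<in> K" "\<And>i. i \<in> {1..n} \<Longrightarrow> norm (q (s + i) - q' i) \<le> \<delta>"
    and small: "0 \<le> \<delta>" "2 * real n * \<delta> \<le> c * \<sigma>"
    and "z \<in> K"
  shows "norm (rbar n) \<le> norm (r s - z) + 2 * real n * \<delta> * norm z / (c * \<sigma>)"
proof -
  obtain a where a: "norm (z - (\<Sum>i=1..n. a i *\<^sub>R q (s + i)))
      \<le> 2 * real (card {1..n}) * \<delta> * norm z / (c * \<sigma>)"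
  proof (rule perturbed_orthogonal_basis[where I = "{1..n}" and q = "\<lambda>i. q (s + i)" and q' = q'
        and K = K and b = "c * \<sigma>" and \<delta> = \<delta> and z = z])
    show "c * \<sigma> \<le> norm (q (s + i))" if "i \<in> {1..n}" for i
      using q_lower[of i] that by (simp add: \<sigma>_def)
    show "0 < c * \<sigma>" using const_pos sigma_pos by simp
  qed (use K q' small \<open>z \<in> K\<close> q_orthogonal in auto)
  let ?w = "\<Sum>i=1..n. a i *\<^sub>R q (s + i)"
  have "norm (rbar n) \<le> norm (r s - ?w)"
    by (rule rbar_minimal[OF order_refl]) (intro span_sum span_scale span_base imageI)
  also have "\<dots> \<le> norm (r s - z) + norm (z - ?w)"
    using norm_triangle_ineq[of "r s - z" "z - ?w"] by simp
  finally show ?thesis using a by simp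
qed

lemma rbar_le_krylov_residual:
  assumes small: "2 * real m * F * \<sigma> \<le> c" and z: "z \<in> A ` krylov n" "norm z \<le> 2 * \<sigma>"
  shows "norm (rbar n) \<le> norm (r s - z) + 4 * real m * F / c * \<sigma> ^ 2"
proof -
  obtain p' where p': "\<And>i. i \<in> {1..n} \<Longrightarrow> p' i \<in> krylov i"
    "\<And>i. i \<in> {1..n} \<Longrightarrow> norm (p (s + i) - p' i) \<le> m * G * E * (1 + 4 * G) ^ m * \<sigma> ^ 2"
    using direction_near_krylov by blast
  have "norm (q (s + i) - (- A (p' i))) \<le> F * \<sigma> ^ 2" if i: "i \<in> {1..n}" for i
  proof -
    obtain i' where i': "i = Suc i'" "i' < n" using i by (cases i) auto
    have "norm (q (s + i) - (- A (p' i))) \<le> norm (q (s + i) + A (p (s + i))) + norm (A (p (s + i) - p' i))"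
      using norm_triangle_ineq4[of "q (s + i) + A (p (s + i))" "A (p (s + i) - p' i)"]
      by (simp add: linear_diff[OF linear])
    also have "\<dots> \<le> E * \<sigma> ^ 2 + 2 * norm (p (s + i) - p' i)"
      using direction_consistent[OF i'(2)] A_upper i'(1) by (intro add_mono) auto
    also have "\<dots> \<le> E * \<sigma> ^ 2 + 2 * (m * G * E * (1 + 4 * G) ^ m * \<sigma> ^ 2)"
      using p'(2)[OF i] by simp
    finally show ?thesis by (simp add: F_def algebra_simps)
  qed
  moreover have "- A (p' i) \<in> A ` krylov n" if i: "i \<in> {1..n}" for i
  proof -
    have "- p' i \<in> krylov n"
      using p'(1)[OF i] krylov_mono[of i n] i unfolding krylov_def by (auto intro: span_neg)
    then show ?thesis using linear_neg[OF linear, of "p' i"] by (metis image_eqI)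
  qed
  moreover have "subspace (A ` krylov n)"
    unfolding krylov_def by (intro linear_subspace_image[OF linear] subspace_span)
  moreover have "dim (A ` krylov n) \<le> n"
    using dim_image_le[OF linear] dim_krylov order_trans by blast
  moreover have nm: "2 * real n * F * \<sigma> \<le> 2 * real m * F * \<sigma>"
    using length const_nonneg sigma_pos by (intro mult_right_mono) auto
  then have "(2 * real n * F * \<sigma>) * \<sigma> \<le> c * \<sigma>"
    using small sigma_pos by (intro mult_right_mono) auto
  then have "2 * real n * (F * \<sigma> ^ 2) \<le> c * \<sigma>" by (simp add: power2_eq_square mult_ac)
  ultimately have "norm (rbar n) \<le> norm (r s - z) + 2 * real n * (F * \<sigma> ^ 2) * norm z / (c * \<sigma>)"
    using z(1) const_nonneg by (intro rbar_le_residual[where q' = "\<lambda>i. - A (p' i)"]) auto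
  also have "2 * real n * (F * \<sigma> ^ 2) * norm z / (c * \<sigma>) \<le> 2 * real m * (F * \<sigma> ^ 2) * (2 * \<sigma>) / (c * \<sigma>)"
    using length const_nonneg z(2) const_pos sigma_pos by (intro divide_right_mono mult_mono) auto
  also have "\<dots> = 4 * real m * F / c * \<sigma> ^ 2" using sigma_pos by simp
  finally show ?thesis by simp
qed

text \<open>
  The case \<open>q' = q\<close>, \<open>\<delta> = 0\<close>, \<open>z = r\<^sub>s\<close> of \<open>rbar_le_residual\<close>.
\<close>

lemma rbar_zero_if_full:
  assumes "n = DIM('a)"
  shows "rbar n = 0"
  using rbar_le_residual[of UNIV "\<lambda>i. q (s + i)" 0 "r s"] assms const_pos sigma_pos
  by (simp add: dim_UNIV)

lemma next_iterate_step: "norm (x (s + Suc n) - x (s + n)) \<le> (m * G * P + H) * \<sigma>"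
proof -
  obtain \<Gamma> where g: "xbar n = x (s + n) - (\<Sum>j=1..n. \<Gamma> j *\<^sub>R p (s + j))"
    "norm (rbar n) \<le> H * \<sigma>" "\<And>j. j \<in> {1..n} \<Longrightarrow> \<bar>\<Gamma> j\<bar> \<le> G"
    using projection[OF order_refl] by blast
  have "norm (\<Sum>j=1..n. \<Gamma> j *\<^sub>R p (s + j)) \<le> (\<Sum>j=1..n. G * (P * \<sigma>))"
    by (rule sum_norm_le)
      (use g(3) direction_bound const_nonneg in \<open>auto intro!: mult_mono\<close>)
  also have "\<dots> = n * (G * P * \<sigma>)" by simp
  also have "\<dots> \<le> m * (G * P * \<sigma>)"
    using const_nonneg sigma_pos length by (intro mult_right_mono) auto
  finally have bound: "norm (rbar n) + norm (\<Sum>j=1..n. \<Gamma> j *\<^sub>R p (s + j)) \<le> (m * G * P + H) * \<sigma>"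
    using g(2) by (simp add: algebra_simps)
  have step: "x (s + Suc n) - x (s + n) = rbar n - (\<Sum>j=1..n. \<Gamma> j *\<^sub>R p (s + j))"
    using next_iterate[OF order_refl] g(1) by simp
  show ?thesis unfolding step by (rule order_trans[OF norm_triangle_ineq4 bound])
qed

text \<open>
  Both \<open>rbar n\<close> and \<open>r\<^sub>s\<^sub>+\<^sub>n\<^sub>+\<^sub>1\<close> are, up to quadratic terms, the images under \<open>-A\<close> of the errors of \<open>xbar n\<close> and of
  \<open>xbar n + rbar n\<close>.  Subtracting leaves \<open>rbar n - A (rbar n)\<close>, which \<open>near_id\<close> contracts.
\<close>

lemma next_residual:
  assumes "norm (r (s + n) + A (x (s + n) - xs)) \<le> D * \<sigma> ^ 2"
    and "norm (r (s + Suc n) + A (x (s + Suc n) - xs)) \<le> D' * \<sigma> ^ 2"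
  shows "norm (r (s + Suc n)) \<le> \<kappa> * norm (rbar n) + (D' + D + m * G * E) * \<sigma> ^ 2"
proof -
  obtain \<Gamma> where g: "xbar n = x (s + n) - (\<Sum>j=1..n. \<Gamma> j *\<^sub>R p (s + j))"
    "rbar n = r (s + n) - (\<Sum>j=1..n. \<Gamma> j *\<^sub>R q (s + j))" "\<And>j. j \<in> {1..n} \<Longrightarrow> \<bar>\<Gamma> j\<bar> \<le> G"
    using projection[OF order_refl] by blast
  have "rbar n + A (xbar n - xs) = (r (s + n) + A (x (s + n) - xs))
       - (\<Sum>j=1..n. \<Gamma> j *\<^sub>R (q (s + j) + A (p (s + j))))"
    unfolding g(1,2) linear_diff[OF linear] linear_sum[OF linear] scaleR_add_right sum.distrib
    by (simp add: o_def linear_cmul[OF linear])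
  also have "norm \<dots> \<le> D * \<sigma> ^ 2 + norm (\<Sum>j=1..n. \<Gamma> j *\<^sub>R (q (s + j) + A (p (s + j))))"
    using assms(1) by (intro order_trans[OF norm_triangle_ineq4]) simp
  also have "norm (\<Sum>j=1..n. \<Gamma> j *\<^sub>R (q (s + j) + A (p (s + j)))) \<le> (\<Sum>j=1..n. G * (E * \<sigma> ^ 2))"
  proof (rule sum_norm_le)
    fix j assume j: "j \<in> {1..n}"
    then obtain j' where "j = Suc j'" "j' < n" by (cases j) auto
    then show "norm (\<Gamma> j *\<^sub>R (q (s + j) + A (p (s + j)))) \<le> G * (E * \<sigma> ^ 2)"
      using direction_consistent[of j'] g(3)[OF j] const_nonneg by (auto intro!: mult_mono)
  qed
  also have "\<dots> = n * (G * E * \<sigma> ^ 2)" by simp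
  also have "\<dots> \<le> m * (G * E * \<sigma> ^ 2)"
    using const_nonneg length by (intro mult_right_mono) auto
  finally have bar: "norm (rbar n + A (xbar n - xs)) \<le> D * \<sigma> ^ 2 + m * (G * E * \<sigma> ^ 2)" by simp
  let ?u = "r (s + Suc n) + A (x (s + Suc n) - xs)" and ?v = "rbar n + A (xbar n - xs)"
    and ?w = "rbar n - A (rbar n)"
  have split: "?u - ?v + ?w = r (s + Suc n)"
    using next_iterate[of n] by (simp add: linear_diff[OF linear] linear_add[OF linear])
  have "norm (?u - ?v + ?w) \<le> norm ?u + norm ?v + norm ?w"
    by (rule order_trans[OF norm_triangle_ineq add_right_mono[OF norm_triangle_ineq4]])
  then have "norm (r (s + Suc n)) \<le> norm ?u + norm ?v + norm ?w"
    unfolding split .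
  also have "\<dots> \<le> D' * \<sigma> ^ 2 + (D * \<sigma> ^ 2 + m * (G * E * \<sigma> ^ 2)) + \<kappa> * norm (rbar n)"
    by (rule add_mono[OF add_mono[OF assms(2) bar] near_id])
  also have "\<dots> = \<kappa> * norm (rbar n) + (D' + D + m * G * E) * \<sigma> ^ 2"
    by (simp add: algebra_simps)
  finally show ?thesis .
qed

end

section \<open>Krylov form of the polynomial minimum\<close>

lemma matrix_power_mult_vec:
  fixes A :: "real^'n^'n"
  shows "((((**) A) ^^ i) (mat 1)) *v v = (((*v) A) ^^ i) v"
  by (induction i) (simp_all add: matrix_vector_mul_assoc[symmetric])

lemma min_poly_residual_le_norm: "min_poly_residual n A v \<le> norm v"
proof -
  have "min_poly_residual n A v \<le> norm (matrix_poly 1 A *v v)"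
    unfolding min_poly_residual_def
    by (rule cINF_lower) (auto intro: bdd_belowI[of _ 0])
  also have "matrix_poly 1 A *v v = v"
    by (simp add: matrix_poly_def)
  finally show ?thesis .
qed

text \<open>
  A polynomial with \<open>p(0) = 1\<close> is \<open>1\<close> minus a multiple of the variable, so \<open>v - p(A) v\<close> is \<open>A\<close> applied to
  an element of the Krylov space.  The bound on \<open>z\<close> holds because \<open>p = 1\<close> competes in the minimum.
\<close>

lemma min_poly_residual_krylov:
  fixes A :: "real^'n^'n"
  obtains z where "z \<in> ((*v) A) ` span ((\<lambda>l. (((*v) A) ^^ l) v) ` {..<n})"
    and "norm (v - z) = min_poly_residual n A v" and "norm z \<le> 2 * norm v"
proof -
  obtain p where p: "degree p \<le> n" "poly p 0 = 1"
    "norm (matrix_poly p A *v v) = min_poly_residual n A v"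
    using min_poly_residual_attained by blast
  let ?pow = "\<lambda>l. (((*v) A) ^^ l) v"
  define y where "y = - (\<Sum>i<n. coeff p (Suc i) *\<^sub>R ?pow i)"
  have "y \<in> span (?pow ` {..<n})"
    unfolding y_def by (intro span_neg span_sum span_scale span_base) auto
  moreover have eq: "matrix_poly p A *v v = v - A *v y"
  proof -
    have "matrix_poly p A *v v = (\<Sum>i\<le>n. coeff p i *\<^sub>R ?pow i)"
      using matrix_poly_mult_vec[OF p(1)] by (simp add: matrix_power_mult_vec)
    also have "\<dots> = v + (\<Sum>i<n. coeff p (Suc i) *\<^sub>R (A *v ?pow i))"
      using p(2) by (simp add: sum.atMost_shift poly_0_coeff_0)
    also have "\<dots> = v - A *v y"
      unfolding y_def
      by (simp add: linear_neg[OF matrix_vector_mul_linear] linear_sum[OF matrix_vector_mul_linear]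
          linear_cmul[OF matrix_vector_mul_linear])
    finally show ?thesis .
  qed
  moreover have "norm (A *v y) \<le> 2 * norm v"
    using min_poly_residual_le_norm[of n A v] p(3) eq norm_triangle_ineq4[of v "v - A *v y"] by simp
  ultimately show thesis using that[of "A *v y"] p(3) by auto
qed

section \<open>Linearisation at the fixed point\<close>

lemma assumption_G_has_derivative:
  assumes "assumption_G g xs \<rho> \<kappa> \<kappa>'" "x \<in> cball xs \<rho>"
  shows "(g has_derivative (*v) (jacobian g (at x within cball xs \<rho>))) (at x within cball xs \<rho>)"
  using assms jacobian_works[of g "at x within cball xs \<rho>"]
  unfolding assumption_G_def differentiable_on_def by auto

lemma assumption_G_jacobian_centre:
  assumes "assumption_G g xs \<rho> \<kappa> \<kappa>'"
  shows "at xs within cball xs \<rho> = at xs"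
proof -
  have "0 < \<rho>" using assms by (simp add: assumption_G_def)
  then have "xs \<in> ball xs \<rho>" by simp
  then have "xs \<in> interior (cball xs \<rho>)" by (simp add: interior_cball)
  then show ?thesis by (rule at_within_interior)
qed

text \<open>
  Difference quotients in the direction \<open>v\<close> are bounded by the Lipschitz constant.
\<close>

lemma assumption_G_jacobian_bound:
  assumes G: "assumption_G g xs \<rho> \<kappa> \<kappa>'"
  shows "norm (jacobian g (at xs) *v v) \<le> \<kappa> * norm v"
proof (cases "v = 0")
  case False
  let ?J = "jacobian g (at xs)"
  have \<rho>: "0 < \<rho>" using G by (simp add: assumption_G_def)
  have D: "(g has_derivative (*v) ?J) (at xs within cball xs \<rho>)"
    using assumption_G_has_derivative[OF G, of xs] assumption_G_jacobian_centre[OF G] \<rho> by simp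
  have "norm (?J *v v) / norm v \<le> \<kappa>"
  proof (rule field_le_epsilon)
    fix e :: real assume "0 < e"
    then obtain d where d: "0 < d"
      "\<And>y. y \<in> cball xs \<rho> \<Longrightarrow> norm (y - xs) < d \<Longrightarrow>
         norm (g y - g xs - ?J *v (y - xs)) \<le> e * norm (y - xs)"
      using D unfolding has_derivative_within_alt by blast
    define t where "t = min \<rho> (d / 2) / norm v"
    have t: "0 < t" "t * norm v \<le> \<rho>" "t * norm v < d"
      using \<rho> d False by (auto simp: t_def)
    let ?y = "xs + t *\<^sub>R v"
    have y: "?y \<in> cball xs \<rho>" "norm (?y - xs) = t * norm v"
      using t by (auto simp: dist_norm)
    have "norm (g ?y - g xs) \<le> \<kappa> * (t * norm v)"
      using G y \<rho> unfolding assumption_G_def by (metis centre_in_cball less_imp_le)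
    moreover have "norm (g ?y - g xs - t *\<^sub>R (?J *v v)) \<le> e * (t * norm v)"
      using d(2)[OF y(1)] y(2) t by (simp add: linear_cmul[OF matrix_vector_mul_linear])
    ultimately have "norm (t *\<^sub>R (?J *v v)) \<le> \<kappa> * (t * norm v) + e * (t * norm v)"
      using norm_triangle_ineq4[of "g ?y - g xs" "g ?y - g xs - t *\<^sub>R (?J *v v)"] by simp
    then have "t * norm (?J *v v) \<le> t * ((\<kappa> + e) * norm v)"
      using t by (simp add: algebra_simps)
    then show "norm (?J *v v) / norm v \<le> \<kappa> + e"
      using t False by (simp add: pos_divide_le_eq)
  qed
  then show ?thesis using False by (simp add: pos_divide_le_eq)
qed simp

text \<open>
  The mean value inequality for \<open>z \<mapsto> g z - g'(x\<^sup>*) z\<close>, whose derivative at \<open>z\<close> is at most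
  \<open>\<kappa>' \<parallel>z - x\<^sup>*\<parallel>\<close>.
\<close>

lemma assumption_G_linearisation:
  assumes G: "assumption_G g xs \<rho> \<kappa> \<kappa>'"
    and xy: "x \<in> cball xs \<rho>" "y \<in> cball xs \<rho>" "norm (x - xs) \<le> R" "norm (y - xs) \<le> R"
  shows "norm (g y - g x - jacobian g (at xs) *v (y - x)) \<le> \<kappa>' * R * norm (y - x)"
proof -
  let ?J = "jacobian g (at xs)" and ?Jx = "\<lambda>z. jacobian g (at z within cball xs \<rho>)"
  \<comment> \<open>Convex, contains both points, and on it the derivative varies by at most \<open>\<kappa>' * R\<close>.\<close>
  let ?S = "cball xs (min \<rho> R)"
  let ?f = "\<lambda>z. g z - ?J *v z"
  have "0 < \<rho>" "0 < \<kappa>'" using G by (auto simp: assumption_G_def)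
  have sub: "?S \<subseteq> cball xs \<rho>" by auto
  have "norm (?f y - ?f x) \<le> \<kappa>' * R * norm (y - x)"
  proof (rule differentiable_bound[where S = ?S and f' = "\<lambda>z v. ?Jx z *v v - ?J *v v"])
    fix z assume z: "z \<in> ?S"
    then have z\<rho>: "z \<in> cball xs \<rho>" by auto
    have "(g has_derivative (*v) (?Jx z)) (at z within ?S)"
      using assumption_G_has_derivative[OF G z\<rho>] sub by (rule has_derivative_subset)
    then show "(?f has_derivative (\<lambda>v. ?Jx z *v v - ?J *v v)) (at z within ?S)"
      by (intro has_derivative_diff bounded_linear_imp_has_derivative
          matrix_vector_mul_bounded_linear)
    have "onorm (\<lambda>v. (?Jx z - ?Jx xs) *v v) \<le> \<kappa>' * norm (z - xs)"
      using G z\<rho> \<open>0 < \<rho>\<close> by (simp add: assumption_G_def)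
    also have "\<dots> \<le> \<kappa>' * R"
      using z \<open>0 < \<kappa>'\<close> by (auto simp: dist_norm norm_minus_commute intro: mult_left_mono)
    finally show "onorm (\<lambda>v. ?Jx z *v v - ?J *v v) \<le> \<kappa>' * R"
      by (simp add: assumption_G_jacobian_centre[OF G] matrix_vector_mult_diff_rdistrib)
  qed (use xy in \<open>auto simp: dist_norm norm_minus_commute\<close>)
  then show ?thesis by (simp add: matrix_vector_mult_diff_distrib algebra_simps)
qed

section \<open>Blocks of a run\<close>

text \<open>
  Unless an iteration restarts, neither restart test triggers and the block of its predecessor is
  continued; the entry value \<open>mm k + 1\<close> of the depth then refers to the same start \<open>k - mm k\<close>.
\<close>

lemma anderson_iteration_extends:
  assumes "anderson_iteration \<beta> m \<tau> \<eta> x r p q mm (Suc k)" "mm (Suc k) \<noteq> 0"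
  shows "mm (Suc k) = Suc (mm k)" "mm (Suc k) \<le> m"
    "norm (r (Suc k)) \<le> \<eta> * norm (r (k - mm k))"
    "(p (Suc k), q (Suc k)) = sweep p q (k - mm k) (mm k) (x (Suc k) - x k, r (Suc k) - r k)"
    "\<tau> * (norm (q (Suc (k - mm k))))\<^sup>2 \<le> (norm (q (Suc k)))\<^sup>2"
  using assms unfolding anderson_iteration_def Let_def
  by (auto simp: power2_norm_eq_inner not_less split: if_splits)

lemma anderson_iteration_next:
  assumes "anderson_iteration \<beta> m \<tau> \<eta> x r p q mm k"
  shows "x (Suc k) = (let (u, v) = sweep p q (k - mm k) (mm k) (x k, r k) in u + \<beta> k *\<^sub>R v)"
  using assms unfolding anderson_iteration_def Let_def by (simp add: case_prod_unfold)

lemma anderson_iteration_0: "anderson_iteration \<beta> m \<tau> \<eta> x r p q mm 0 \<Longrightarrow> mm 0 = 0"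
  unfolding anderson_iteration_def Let_def by (auto split: if_splits)

lemma anderson_depth_in_block:
  assumes it: "\<And>j. j \<le> k \<Longrightarrow> anderson_iteration \<beta> m \<tau> \<eta> x r p q mm j"
  shows "mm k \<le> k \<and> mm k \<le> m \<and> (\<forall>i\<le>mm k. mm (k - mm k + i) = i)"
  using it
proof (induction k)
  case 0
  then show ?case using anderson_iteration_0 by fastforce
next
  case (Suc k)
  then have IH: "mm k \<le> k" "mm k \<le> m" "\<And>i. i \<le> mm k \<Longrightarrow> mm (k - mm k + i) = i" by auto
  show ?case
  proof (cases "mm (Suc k) = 0")
    case False
    have e: "mm (Suc k) = Suc (mm k)" "mm (Suc k) \<le> m"
      using anderson_iteration_extends[OF Suc.prems[OF order_refl] False] by auto
    have "mm (k - mm k + i) = i" if "i \<le> Suc (mm k)" for i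
      using that IH e by (cases "i = Suc (mm k)") auto
    then show ?thesis using e IH(1) by auto
  qed simp
qed

text \<open>
  Inside the current block no restart has happened, so the conditions that the method checked at the
  earlier indices of the block all refer to its start \<open>s\<close>.
\<close>

lemma anderson_block_structure:
  assumes it: "\<And>j. j \<le> k \<Longrightarrow> anderson_iteration \<beta> m \<tau> \<eta> x r p q mm j"
  defines "s \<equiv> k - mm k"
  shows "i < mm k \<Longrightarrow> norm (r (s + Suc i)) \<le> \<eta> * norm (r s)"
    and "i < mm k \<Longrightarrow> (p (s + Suc i), q (s + Suc i)) =
          sweep p q s i (x (s + Suc i) - x (s + i), r (s + Suc i) - r (s + i))"
    and "i < mm k \<Longrightarrow> \<tau> * (norm (q (Suc s)))\<^sup>2 \<le> (norm (q (s + Suc i)))\<^sup>2"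
    and "i \<le> mm k \<Longrightarrow> x (s + Suc i) =
          (let (u, v) = sweep p q s i (x (s + i), r (s + i)) in u + \<beta> (s + i) *\<^sub>R v)"
proof -
  have d: "mm k \<le> k" "\<And>i. i \<le> mm k \<Longrightarrow> mm (s + i) = i"
    using anderson_depth_in_block[of k] it unfolding s_def by blast+
  {
    assume i: "i < mm k"
    have "anderson_iteration \<beta> m \<tau> \<eta> x r p q mm (Suc (s + i))" "mm (Suc (s + i)) \<noteq> 0"
      using d(2)[of "Suc i"] i d(1) by (auto intro!: it simp: s_def)
    note e = anderson_iteration_extends(3-5)[OF this]
    show "norm (r (s + Suc i)) \<le> \<eta> * norm (r s)"
      "(p (s + Suc i), q (s + Suc i)) =
          sweep p q s i (x (s + Suc i) - x (s + i), r (s + Suc i) - r (s + i))"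
      "\<tau> * (norm (q (Suc s)))\<^sup>2 \<le> (norm (q (s + Suc i)))\<^sup>2"
      using e d(2)[of i] i by auto
  }
  {
    assume i: "i \<le> mm k"
    have "anderson_iteration \<beta> m \<tau> \<eta> x r p q mm (s + i)"
      using i d(1) by (auto intro!: it simp: s_def)
    from anderson_iteration_next[OF this] d(2)[OF i]
    show "x (s + Suc i) =
          (let (u, v) = sweep p q s i (x (s + i), r (s + i)) in u + \<beta> (s + i) *\<^sub>R v)"
      by simp
  }
qed

section \<open>Uniform constants and the invariant of the block starts\<close>

locale anderson_constants =
  fixes g :: "real^'n \<Rightarrow> real^'n" and xs :: "real^'n" and \<rho> \<kappa> \<kappa>' :: real
    and m :: nat and \<tau> \<eta> :: real
  assumes contraction: "assumption_G g xs \<rho> \<kappa> \<kappa>'" and tau: "0 < \<tau>"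
begin

definition "J = jacobian g (at xs)"
text \<open>
  For a block starting with \<open>\<sigma> = \<parallel>r\<^sub>s\<parallel>\<close>: the residuals are at most \<open>H \<sigma>\<close> (the restart test gives \<open>\<eta> \<sigma>\<close>
  after the start, and \<open>H \<ge> 1\<close> covers the start itself), the \<open>q\<^sub>j\<close> at least \<open>c \<sigma>\<close>, the errors of the iterates
  at most \<open>B \<sigma>\<close>, the linearisation errors at most \<open>D \<sigma>\<^sup>2\<close>, and the error of the next iterate at most \<open>W \<sigma>\<close>.
  The bound \<open>\<delta>\<close> on \<open>\<sigma>\<close> keeps the next iterate in the ball, makes the perturbed basis
  well-conditioned and lets the quadratic term \<open>C \<sigma>\<^sup>2\<close> be absorbed by the contraction.
\<close>

definition "H = max 1 \<eta>"
definition "c = sqrt \<tau> * (1 - \<kappa>)"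
definition "B = H / (1 - \<kappa>)"
definition "D = 2 * \<kappa>' * B\<^sup>2"
definition "W = B + m * anderson_block.G H c * anderson_block.P \<kappa> D H c m + H"
definition "C = \<kappa>' * W\<^sup>2 + D + m * anderson_block.G H c * anderson_block.E D H c m
  + 4 * real m * anderson_block.F D H c m / c"
definition "\<delta> = Min {1, \<rho> / W, c / (2 * real m * anderson_block.F D H c m + 1), (1 - \<kappa>) / (C + 1)}"

lemma params: "g xs = xs" "0 < \<rho>" "0 < \<kappa>" "\<kappa> < 1" "0 < \<kappa>'"
  using contraction by (auto simp: assumption_G_def)

lemma lipschitz: "x \<in> cball xs \<rho> \<Longrightarrow> y \<in> cball xs \<rho> \<Longrightarrow> norm (g y - g x) \<le> \<kappa> * norm (y - x)"
  using contraction by (auto simp: assumption_G_def)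

lemma residual_difference_ge:
  assumes "x \<in> cball xs \<rho>" "y \<in> cball xs \<rho>"
  shows "(1 - \<kappa>) * norm (y - x) \<le> norm ((g y - y) - (g x - x))"
proof -
  have "norm (y - x) - norm (g y - g x) \<le> norm ((y - x) - (g y - g x))"
    by (rule norm_triangle_ineq2)
  also have "\<dots> = norm ((g y - y) - (g x - x))"
    by (subst norm_minus_commute) (simp add: algebra_simps)
  finally show ?thesis using lipschitz[OF assms] by (simp add: algebra_simps)
qed

lemma residual_ge: "x \<in> cball xs \<rho> \<Longrightarrow> (1 - \<kappa>) * norm (x - xs) \<le> norm (g x - x)"
  using residual_difference_ge[of xs x] params by simp

lemma residual_le: "x \<in> cball xs \<rho> \<Longrightarrow> norm (g x - x) \<le> 2 * norm (x - xs)"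
proof -
  assume x: "x \<in> cball xs \<rho>"
  have "norm (g x - x) \<le> norm (g x - g xs) + norm (x - xs)"
    using norm_triangle_ineq4[of "g x - g xs" "x - xs"] params by simp
  also have "norm (g x - g xs) \<le> \<kappa> * norm (x - xs)"
    using lipschitz[OF _ x, of xs] params by simp
  also have "\<kappa> * norm (x - xs) \<le> 1 * norm (x - xs)"
    using params by (intro mult_right_mono) auto
  finally show ?thesis by simp
qed

lemma residual_linearisation:
  assumes "x \<in> cball xs \<rho>" "y \<in> cball xs \<rho>" "norm (x - xs) \<le> R" "norm (y - xs) \<le> R"
  shows "norm ((g y - y) - (g x - x) + (mat 1 - J) *v (y - x)) \<le> \<kappa>' * R * norm (y - x)"
proof -
  have eq: "(g y - y) - (g x - x) + (mat 1 - J) *v (y - x) = g y - g x - J *v (y - x)"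
    by (simp add: matrix_vector_mult_diff_rdistrib)
  show ?thesis
    unfolding eq using assumption_G_linearisation[OF contraction assms] by (simp only: J_def)
qed

lemma const_pos: "1 \<le> H" "0 < c" "0 < B" "0 < D"
  using params tau by (auto simp: H_def c_def B_def D_def)

text \<open>
  The constants do not depend on the block, so their signs can be read off from a degenerate one of
  length \<open>0\<close>: the identity as linear map, the start \<open>0\<close> and a unit vector as residual.
\<close>

lemma block_const_nonneg:
  "0 \<le> anderson_block.G H c" "0 \<le> anderson_block.E D H c m"
  "0 \<le> anderson_block.P \<kappa> D H c m" "0 \<le> anderson_block.F D H c m"
proof -
  define r where "r = (\<lambda>_::nat. axis undefined 1 :: real^'n)"
  have "norm (r 0) = 1" by (simp add: r_def norm_axis_1)
  then have "r 0 \<noteq> 0" by auto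
  interpret anderson_block "\<lambda>v. v" \<kappa> D H c m 0 0 "\<lambda>i. if i = 0 then 0 else r 0" r r r
    by standard (use params const_pos \<open>norm (r 0) = 1\<close> \<open>r 0 \<noteq> 0\<close> in \<open>auto simp: linear_id[unfolded id_def]\<close>)
  show "0 \<le> anderson_block.G H c" "0 \<le> anderson_block.E D H c m"
  "0 \<le> anderson_block.P \<kappa> D H c m" "0 \<le> anderson_block.F D H c m"
    by (rule const_nonneg)+
qed

lemma W_pos: "0 < W" and C_pos: "0 < C"
proof -
  show W: "0 < W" using const_pos block_const_nonneg by (simp add: W_def add_pos_nonneg)
  show "0 < C" using const_pos block_const_nonneg params
    by (simp add: C_def add_pos_nonneg add_nonneg_pos add_nonneg_nonneg)
qed

lemma delta: "0 < \<delta>" "\<delta> \<le> 1" "W * \<delta> \<le> \<rho>"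
  "2 * real m * anderson_block.F D H c m * \<delta> \<le> c" "C * \<delta> \<le> 1 - \<kappa>"
proof -
  let ?F = "2 * real m * anderson_block.F D H c m"
  have F: "0 \<le> ?F" using block_const_nonneg by simp
  show "0 < \<delta>" using params W_pos C_pos const_pos F by (simp add: \<delta>_def)
  show "\<delta> \<le> 1" by (simp add: \<delta>_def)
  have "\<delta> \<le> \<rho> / W" by (simp add: \<delta>_def)
  then show "W * \<delta> \<le> \<rho>" using W_pos by (simp add: pos_le_divide_eq mult.commute)
  have "\<delta> \<le> c / (?F + 1)" by (simp add: \<delta>_def)
  then have "\<delta> * ?F + \<delta> \<le> c" using F by (simp add: pos_le_divide_eq distrib_left)
  then show "?F * \<delta> \<le> c" using \<open>0 < \<delta>\<close> by (simp add: mult.commute)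
  have "\<delta> \<le> (1 - \<kappa>) / (C + 1)" by (simp add: \<delta>_def)
  then have "\<delta> * C + \<delta> \<le> 1 - \<kappa>" using C_pos by (simp add: pos_le_divide_eq distrib_left)
  then show "C * \<delta> \<le> 1 - \<kappa>" using \<open>0 < \<delta>\<close> by (simp add: mult.commute)
qed

text \<open>
  A block of the method satisfies the abstract block conditions for \<open>A = I - g'(x\<^sup>*)\<close>.  The first
  direction satisfies \<open>\<parallel>q\<^sub>s\<^sub>+\<^sub>1\<parallel> \<ge> (1 - \<kappa>) \<sigma>\<close>, because the step \<open>x\<^sub>s\<^sub>+\<^sub>1 - x\<^sub>s\<close> is \<open>r\<^sub>s\<close>, and the second restart test
  carries this bound to the later directions with the factor \<open>sqrt \<tau>\<close>.
\<close>

lemma block_step: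
  fixes k :: nat
  assumes it: "\<And>j. j \<le> k \<Longrightarrow> anderson_iteration (\<lambda>_. 1) m \<tau> \<eta> x r p q mm j"
    and res: "\<And>j. j \<le> Suc k \<Longrightarrow> r j = g (x j) - x j" and nz: "\<And>j. j \<le> k \<Longrightarrow> r j \<noteq> 0"
    and ball: "\<And>j. j \<le> k \<Longrightarrow> x j \<in> cball xs \<rho>"
    and small: "norm (r (k - mm k)) \<le> \<delta>"
  shows "x (Suc k) \<in> cball xs \<rho>"
    and "norm (r (Suc k)) \<le> \<kappa> * min_poly_residual (mm k) (mat 1 - J) (r (k - mm k))
           + C * (norm (r (k - mm k)))\<^sup>2"
    and "mm k = CARD('n) \<Longrightarrow> norm (r (Suc k)) \<le> C * (norm (r (k - mm k)))\<^sup>2"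
proof -
  define s where "s = k - mm k"
  define A where "A = (*v) (mat 1 - J)"
  have depth: "mm k \<le> k" "mm k \<le> m" using anderson_depth_in_block[of k] it by blast+
  then have sk: "s + mm k = k" by (simp add: s_def)
  have struct:
    "i < mm k \<Longrightarrow> norm (r (s + Suc i)) \<le> \<eta> * norm (r s)"
    "i < mm k \<Longrightarrow> (p (s + Suc i), q (s + Suc i)) =
          sweep p q s i (x (s + Suc i) - x (s + i), r (s + Suc i) - r (s + i))"
    "i < mm k \<Longrightarrow> \<tau> * (norm (q (Suc s)))\<^sup>2 \<le> (norm (q (s + Suc i)))\<^sup>2"
    "i \<le> mm k \<Longrightarrow> x (s + Suc i) = (let (u, v) = sweep p q s i (x (s + i), r (s + i)) in u + v)" for i
    unfolding s_def using anderson_block_structure[of k "\<lambda>_. 1", OF it] by auto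
  let ?\<sigma> = "norm (r s)"
  have \<sigma>: "0 < ?\<sigma>" "?\<sigma> \<le> \<delta>" using nz[of s] small by (auto simp: s_def)
  have rbound: "norm (r (s + i)) \<le> H * ?\<sigma>" if "i \<le> mm k" for i
  proof (cases i)
    case 0
    have "1 * ?\<sigma> \<le> H * ?\<sigma>" using const_pos by (intro mult_right_mono) auto
    then show ?thesis using 0 by simp
  next
    case (Suc i')
    have "\<eta> * ?\<sigma> \<le> H * ?\<sigma>" by (intro mult_right_mono) (auto simp: H_def)
    then show ?thesis using struct(1)[of i'] Suc that by simp
  qed
  have inball: "x (s + i) \<in> cball xs \<rho>" "r (s + i) = g (x (s + i)) - x (s + i)" if "i \<le> mm k" for i
    using ball[of "s + i"] res[of "s + i"] that sk by auto
  have err: "norm (x (s + i) - xs) \<le> B * ?\<sigma>" if "i \<le> mm k" for i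
  proof -
    have "(1 - \<kappa>) * norm (x (s + i) - xs) \<le> H * ?\<sigma>"
      using residual_ge[OF inball(1)[OF that]] inball(2)[OF that] rbound[OF that] by simp
    then show ?thesis using params by (simp add: B_def pos_le_divide_eq mult.commute)
  qed
  have lin: "linear A" unfolding A_def by simp
  interpret anderson_block A \<kappa> D H c m "mm k" s x r p q
  proof (rule anderson_block.intro)
    show "norm (v - A v) \<le> \<kappa> * norm v" for v
      using assumption_G_jacobian_bound[OF contraction, of v]
      by (simp add: A_def J_def matrix_vector_mult_diff_rdistrib)
    show "c * norm (r s) \<le> norm (q (s + i))" if i: "1 \<le> i" "i \<le> mm k" for i
    proof -
      have "x (Suc s) - x s = r s" using struct(4)[of 0] by simp
      moreover have "q (Suc s) = r (Suc s) - r s" using struct(2)[of 0] i by simp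
      ultimately have "(1 - \<kappa>) * norm (r s) \<le> norm (q (Suc s))"
        using residual_difference_ge[of "x s" "x (Suc s)"] inball[of 0] inball[of 1] i by simp
      then have "sqrt \<tau> * ((1 - \<kappa>) * norm (r s)) \<le> sqrt \<tau> * norm (q (Suc s))"
        using tau by (intro mult_left_mono) auto
      also have "\<dots> \<le> norm (q (s + i))"
      proof (rule power2_le_imp_le)
        obtain i' where "i = Suc i'" "i' < mm k" using i by (cases i) auto
        then show "(sqrt \<tau> * norm (q (Suc s)))\<^sup>2 \<le> (norm (q (s + i)))\<^sup>2"
          using struct(3)[of i'] tau by (simp add: power_mult_distrib)
      qed simp
      finally show ?thesis by (simp add: c_def mult_ac)
    qed
    show "norm (r (s + Suc i) - r (s + i) + A (x (s + Suc i) - x (s + i))) \<le> D * (norm (r s))\<^sup>2"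
      if i: "i < mm k" for i
    proof -
      let ?a = "x (s + i)" and ?b = "x (s + Suc i)"
      have i': "i \<le> mm k" "Suc i \<le> mm k" using i by auto
      have "norm (r (s + Suc i) - r (s + i) + A (?b - ?a)) \<le> \<kappa>' * (B * ?\<sigma>) * norm (?b - ?a)"
        unfolding inball(2)[OF i'(1)] inball(2)[OF i'(2)] A_def
        by (rule residual_linearisation[OF inball(1)[OF i'(1)] inball(1)[OF i'(2)] err[OF i'(1)] err[OF i'(2)]])
      also have "norm (?b - ?a) \<le> 2 * B * ?\<sigma>"
        using norm_triangle_ineq4[of "?b - xs" "?a - xs"] err[OF i'(1)] err[OF i'(2)] by simp
      then have "\<kappa>' * (B * ?\<sigma>) * norm (?b - ?a) \<le> \<kappa>' * (B * ?\<sigma>) * (2 * B * ?\<sigma>)"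
        using params const_pos by (intro mult_left_mono) auto
      also have "\<dots> = D * ?\<sigma>\<^sup>2" by (simp add: D_def power2_eq_square)
      finally show ?thesis .
    qed
    show "r s \<noteq> 0" "norm (r s) \<le> 1" using \<sigma> delta(2) by auto
  qed (fact lin params const_pos const_pos(4)[THEN less_imp_le] depth rbound struct)+
  have "norm (x (s + Suc (mm k)) - xs) \<le> norm (x (s + Suc (mm k)) - x (s + mm k)) + norm (x (s + mm k) - xs)"
    using norm_triangle_ineq[of "x (s + Suc (mm k)) - x (s + mm k)" "x (s + mm k) - xs"] by simp
  also have "\<dots> \<le> W * ?\<sigma>"
    using next_iterate_step err[of "mm k"] by (simp add: W_def \<sigma>_def algebra_simps)
  finally have W: "norm (x (Suc k) - xs) \<le> W * ?\<sigma>" using sk by simp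
  also have "\<dots> \<le> W * \<delta>" using \<sigma> W_pos by (intro mult_left_mono) auto
  finally show in_ball: "x (Suc k) \<in> cball xs \<rho>"
    using delta(3) by (simp add: dist_norm norm_minus_commute)
  have lin_at: "norm (r j + A (x j - xs)) \<le> \<kappa>' * R\<^sup>2 * ?\<sigma>\<^sup>2"
    if "j \<le> Suc k" "x j \<in> cball xs \<rho>" "norm (x j - xs) \<le> R * ?\<sigma>" for j R
  proof -
    have "norm (r j + A (x j - xs)) \<le> \<kappa>' * (R * ?\<sigma>) * norm (x j - xs)"
      using residual_linearisation[of xs "x j" "R * ?\<sigma>"] that res[OF that(1)] params
        norm_ge_zero[of "x j - xs"] by (simp add: A_def del: norm_ge_zero)
    also have "\<dots> \<le> \<kappa>' * (R * ?\<sigma>) * (R * ?\<sigma>)"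
    proof (rule mult_left_mono[OF that(3)])
      have "0 \<le> R * ?\<sigma>" using order_trans[OF norm_ge_zero that(3)] .
      then show "0 \<le> \<kappa>' * (R * ?\<sigma>)"
        using params(5) by (intro mult_nonneg_nonneg[of \<kappa>']) auto
    qed
    also have "\<dots> = \<kappa>' * R\<^sup>2 * ?\<sigma>\<^sup>2" by (simp add: power2_eq_square)
    finally show ?thesis .
  qed
  have "\<kappa>' * B\<^sup>2 * ?\<sigma>\<^sup>2 \<le> D * ?\<sigma>\<^sup>2"
    using params by (intro mult_right_mono) (auto simp: D_def)
  then have "norm (r (s + mm k) + A (x (s + mm k) - xs)) \<le> D * \<sigma>\<^sup>2"
    using lin_at[of k B] ball[of k] err[of "mm k"] sk by (simp add: \<sigma>_def)
  moreover have "norm (r (s + Suc (mm k)) + A (x (s + Suc (mm k)) - xs)) \<le> (\<kappa>' * W\<^sup>2) * \<sigma>\<^sup>2"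
    using lin_at[of "Suc k" W] in_ball W sk by (simp add: \<sigma>_def)
  ultimately have main: "norm (r (Suc k)) \<le> \<kappa> * norm (rbar (mm k)) + (\<kappa>' * W\<^sup>2 + D + m * G * E) * \<sigma>\<^sup>2"
    using next_residual[of xs "\<kappa>' * W\<^sup>2"] sk by simp
  have F: "0 \<le> 4 * real m * F / c * \<sigma>\<^sup>2" using const_nonneg const_pos by simp
  have C: "C * ?\<sigma>\<^sup>2 = (\<kappa>' * W\<^sup>2 + D + m * G * E) * \<sigma>\<^sup>2 + 4 * real m * F / c * \<sigma>\<^sup>2"
    by (simp add: C_def \<sigma>_def distrib_right)
  obtain z where z: "z \<in> A ` krylov (mm k)"
    "norm (r s - z) = min_poly_residual (mm k) (mat 1 - J) (r s)" "norm z \<le> 2 * \<sigma>"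
    unfolding krylov_def \<sigma>_def unfolding A_def
    by (rule min_poly_residual_krylov[of "mat 1 - J" "r s" "mm k"])
  have "2 * real m * F * \<sigma> \<le> 2 * real m * F * \<delta>"
    using \<sigma> const_nonneg by (intro mult_left_mono) (auto simp: \<sigma>_def)
  then have "norm (rbar (mm k)) \<le> min_poly_residual (mm k) (mat 1 - J) (r s) + 4 * real m * F / c * \<sigma>\<^sup>2"
    using rbar_le_krylov_residual[OF _ z(1,3)] delta(4) z(2) by simp
  then have "\<kappa> * norm (rbar (mm k)) \<le> \<kappa> * (min_poly_residual (mm k) (mat 1 - J) (r s) + 4 * real m * F / c * \<sigma>\<^sup>2)"
    using params by (intro mult_left_mono) auto
  also have "\<dots> \<le> \<kappa> * min_poly_residual (mm k) (mat 1 - J) (r s) + 4 * real m * F / c * \<sigma>\<^sup>2"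
    using mult_left_le_one_le[OF F, of \<kappa>] params unfolding distrib_left by linarith
  finally show "norm (r (Suc k)) \<le> \<kappa> * min_poly_residual (mm k) (mat 1 - J) (r (k - mm k))
           + C * (norm (r (k - mm k)))\<^sup>2"
    using main C by (simp only: s_def[symmetric])
  show "norm (r (Suc k)) \<le> C * (norm (r (k - mm k)))\<^sup>2" if "mm k = CARD('n)"
  proof -
    have "rbar (mm k) = 0" using rbar_zero_if_full that by simp
    then show ?thesis using main C F unfolding s_def[symmetric] by simp
  qed
qed

lemma restarted_anderson_residual:
  assumes "restarted_anderson g (\<lambda>_. 1) m \<tau> \<eta> x0 x r p q mm" "\<And>j. j < k \<Longrightarrow> r j \<noteq> 0"
  shows "r k = g (x k) - x k"
  using assms unfolding restarted_anderson_def by blast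

lemma restarted_anderson_iteration:
  assumes "restarted_anderson g (\<lambda>_. 1) m \<tau> \<eta> x0 x r p q mm" "\<And>j. j \<le> k \<Longrightarrow> r j \<noteq> 0"
  shows "anderson_iteration (\<lambda>_. 1) m \<tau> \<eta> x r p q mm k"
  using assms unfolding restarted_anderson_def by (blast intro: less_imp_le)

text \<open>
  Comparing with the polynomial \<open>1\<close> shows \<open>\<parallel>r\<^sub>k\<^sub>+\<^sub>1\<parallel> \<le> \<parallel>r\<^sub>s\<parallel>\<close> for the start \<open>s\<close> of the current block.  The next
  index either continues the block or starts a new one with this smaller residual.
\<close>

lemma residuals_stay_small:
  assumes run: "restarted_anderson g (\<lambda>_. 1) m \<tau> \<eta> x0 x r p q mm"
    and start: "x0 \<in> cball xs \<rho>" "norm (g x0 - x0) \<le> \<delta>"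
    and nz: "\<And>j. j \<le> k \<Longrightarrow> r j \<noteq> 0"
  shows "(\<forall>j\<le>k. x j \<in> cball xs \<rho>) \<and> norm (r (k - mm k)) \<le> \<delta>"
  using nz
proof (induction k)
  case 0
  then show ?case using run start unfolding restarted_anderson_def by auto
next
  case (Suc k)
  have it: "anderson_iteration (\<lambda>_. 1) m \<tau> \<eta> x r p q mm j" "r j = g (x j) - x j" if "j \<le> Suc k" for j
    by (rule restarted_anderson_iteration[OF run] restarted_anderson_residual[OF run]; use Suc.prems that in simp)+
  have IH: "\<And>j. j \<le> k \<Longrightarrow> x j \<in> cball xs \<rho>" "norm (r (k - mm k)) \<le> \<delta>"
    using Suc by auto
  have nz: "\<And>j. j \<le> k \<Longrightarrow> r j \<noteq> 0" using Suc.prems by auto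
  note step = block_step[OF it(1)[OF le_SucI] it(2) nz IH]
  let ?\<sigma> = "norm (r (k - mm k))"
  have "norm (r (Suc k)) \<le> \<kappa> * ?\<sigma> + C * ?\<sigma>\<^sup>2"
    using step(2) mult_left_mono[OF min_poly_residual_le_norm[of "mm k" "mat 1 - J" "r (k - mm k)"], of \<kappa>] params
    by linarith
  also have "C * ?\<sigma>\<^sup>2 = (C * ?\<sigma>) * ?\<sigma>" by (simp add: power2_eq_square)
  also have "C * ?\<sigma> * ?\<sigma> \<le> (1 - \<kappa>) * ?\<sigma>"
    using order_trans[OF mult_left_mono[OF IH(2) less_imp_le[OF C_pos]] delta(5)]
    by (rule mult_right_mono) simp
  finally have "norm (r (Suc k)) \<le> ?\<sigma>" by (simp add: algebra_simps)
  then have small: "norm (r (Suc k)) \<le> \<delta>" using IH(2) by simp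
  have "norm (r (Suc k - mm (Suc k))) \<le> \<delta>"
  proof (cases "mm (Suc k) = 0")
    case False
    then show ?thesis
      using anderson_iteration_extends(1)[OF it(1)[OF order_refl]] IH(2) by simp
  qed (use small in simp)
  moreover have "\<forall>j\<le>Suc k. x j \<in> cball xs \<rho>" using IH(1) step(1) by (simp add: le_Suc_eq)
  ultimately show ?case by blast
qed

text \<open>
  The factor \<open>4\<close> converts \<open>\<parallel>r\<^sub>s\<parallel>\<^sup>2\<close> into \<open>\<parallel>x\<^sub>s - x\<^sup>*\<parallel>\<^sup>2\<close>, the division by \<open>1 - \<kappa>\<close> turns the residual of the last
  iterate into its error, and the division by \<open>\<kappa>'\<close> cancels the factor in front.
\<close>

lemma block_error_bounds:
  assumes run: "restarted_anderson g (\<lambda>_. 1) m \<tau> \<eta> x0 x r p q mm"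
    and start: "norm (x0 - xs) \<le> min \<rho> (\<delta> / 2)"
    and nz: "\<And>j. j \<le> k \<Longrightarrow> r j \<noteq> 0"
  defines "e \<equiv> norm (x (k - mm k) - xs)"
  shows "norm (r (Suc k)) \<le> \<kappa> * min_poly_residual (mm k) (mat 1 - J) (r (k - mm k))
          + \<kappa>' * (4 * C / (\<kappa>' * (1 - \<kappa>)) * e\<^sup>2)"
    and "mm k = CARD('n) \<Longrightarrow> norm (x (Suc k) - xs) \<le> \<kappa>' * (4 * C / (\<kappa>' * (1 - \<kappa>)) * e\<^sup>2)"
proof -
  have "x0 \<in> cball xs \<rho>" using start by (simp add: dist_norm norm_minus_commute)
  moreover from this have "norm (g x0 - x0) \<le> \<delta>" using residual_le[of x0] start by simp
  ultimately have inv: "\<And>j. j \<le> k \<Longrightarrow> x j \<in> cball xs \<rho>" "norm (r (k - mm k)) \<le> \<delta>"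
    using residuals_stay_small[OF run _ _ nz] by auto
  have it: "j \<le> k \<Longrightarrow> anderson_iteration (\<lambda>_. 1) m \<tau> \<eta> x r p q mm j"
    "j \<le> Suc k \<Longrightarrow> r j = g (x j) - x j" for j
    by (rule restarted_anderson_iteration[OF run] restarted_anderson_residual[OF run]; use nz in simp)+
  note step = block_step[OF it nz inv]
  have "norm (r (k - mm k)) \<le> 2 * e"
    using residual_le[OF inv(1), of "k - mm k"] it(2)[of "k - mm k"] by (simp add: e_def)
  then have "(norm (r (k - mm k)))\<^sup>2 \<le> (2 * e)\<^sup>2" by (intro power_mono) auto
  then have sq: "C * (norm (r (k - mm k)))\<^sup>2 \<le> 4 * C * e\<^sup>2"
    using C_pos by (simp add: power_mult_distrib)
  have eq: "\<kappa>' * (4 * C / (\<kappa>' * (1 - \<kappa>)) * e\<^sup>2) = 4 * C * e\<^sup>2 / (1 - \<kappa>)"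
    using params by simp
  have "4 * C * e\<^sup>2 * (1 - \<kappa>) \<le> 4 * C * e\<^sup>2 * 1"
    using params C_pos by (intro mult_left_mono) auto
  then have "4 * C * e\<^sup>2 \<le> 4 * C * e\<^sup>2 / (1 - \<kappa>)"
    using params by (simp add: pos_le_divide_eq)
  then show "norm (r (Suc k)) \<le> \<kappa> * min_poly_residual (mm k) (mat 1 - J) (r (k - mm k))
          + \<kappa>' * (4 * C / (\<kappa>' * (1 - \<kappa>)) * e\<^sup>2)"
    unfolding eq using step(2) sq by linarith
  show "norm (x (Suc k) - xs) \<le> \<kappa>' * (4 * C / (\<kappa>' * (1 - \<kappa>)) * e\<^sup>2)" if "mm k = CARD('n)"
  proof -
    have "(1 - \<kappa>) * norm (x (Suc k) - xs) \<le> 4 * C * e\<^sup>2"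
      using residual_ge[OF step(1)] it(2)[of "Suc k"] step(3)[OF _ _ _ _ that] sq by simp
    then show ?thesis unfolding eq using params by (simp add: pos_le_divide_eq mult.commute)
  qed
qed

end

theorem corollary4p10:
  fixes g :: "real^'n \<Rightarrow> real^'n" and xstar :: "real^'n"
    and \<rho> \<kappa> \<kappa>' \<tau> \<eta> :: real and m :: nat
  assumes "assumption_G g xstar \<rho> \<kappa> \<kappa>'"
    and "0 < m" and "m \<le> CARD('n)"
    and "0 < \<tau>" and "\<tau> < 1" and "0 < \<eta>"
  shows "\<exists>\<epsilon>>0. \<exists>C>0. \<forall>x0 x r p q mm.
           norm (x0 - xstar) \<le> \<epsilon> \<longrightarrow>
           restarted_anderson g (\<lambda>_. 1) m \<tau> \<eta> x0 x r p q mm \<longrightarrow>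
           (\<forall>k. (\<forall>j\<le>k. r j \<noteq> 0) \<longrightarrow>
              norm (r (k + 1))
                \<le> \<kappa> * min_poly_residual (mm k) (mat 1 - jacobian g (at xstar)) (r (k - mm k))
                   + \<kappa>' * (C * norm (x (k - mm k) - xstar) ^ 2) \<and>
              (mm k = CARD('n) \<longrightarrow>
                 norm (x (k + 1) - xstar) \<le> \<kappa>' * (C * norm (x (k - mm k) - xstar) ^ 2)))"
proof -
  interpret anderson_constants g xstar \<rho> \<kappa> \<kappa>' m \<tau> \<eta>
    by standard (use assms in auto)
  have "0 < min \<rho> (\<delta> / 2)" using params delta by simp
  moreover have "0 < 4 * C / (\<kappa>' * (1 - \<kappa>))" using params C_pos by simp
  moreover note block_error_bounds[unfolded J_def]
  ultimately show ?thesis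
    unfolding Suc_eq_plus1[symmetric]
    by (intro exI[of _ "min \<rho> (\<delta> / 2)"] exI[of _ "4 * C / (\<kappa>' * (1 - \<kappa>))"] conjI allI impI) blast+
qed

end
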